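(* The $*$-weakly compact set $\mathcal S_{\mathbb Z}(\mathfrak R_m)$ of shift invariant states on the Monotone $C^*$-algebra $\mathfrak R_m$ is given by $$\mathcal S_{\mathbb Z}(\mathfrak R_m)=\{(1-\gamma)\omega_\infty+\gamma\omega\mid\gamma\in[0,1]\},$$ where $\omega$ is the Monotone vacuum state and $\omega_\infty$ is the state at infinity.
   Context: For $k\ge1$ let $I_k=\{(i_1,\dots,i_k)\in\mathbb Z^k\mid i_1<\cdots<i_k\}$, and $I_0=\{\emptyset\}$. The Monotone Fock space is $\mathcal F_m=\bigoplus_{k\ge0}\ell^2(I_k)$, with canonical orthonormal basis $e_{(i_1,\dots,i_k)}$ and vacuum $\Omega=e_\emptyset$. For $i\in\mathbb Z$, the creation operator is $a_i^\dagger e_{(i_1,\dots,i_k)}=e_{(i,i_1,\dots,i_k)}$ if $i<i_1$ and $0$ otherwise, with $a_i^\dagger\Omega=e_{(i)}$; the annihilation operator is $a_ie_{(i_1,\dots,i_k)}=e_{(i_2,\dots,i_k)}$ if $k\ge1$ and $i=i_1$, and $0$ otherwise. They are bounded and mutually adjoint. $\mathfrak R_m$ is the unital $C^*$-algebra on $\mathcal F_m$ generated by $\{a_i\mid i\in\mathbb Z\}$. The shift is the automorphism $\alpha$ of $\mathfrak R_m$ with $\alpha(a_i)=a_{i+1}$, implemented by the unitary $e_{(i_1,\dots,i_k)}\mapsto e_{(i_1+1,\dots,i_k+1)}$, $\Omega\mapsto\Omega$. A state $\varphi$ is shift invariant if $\varphi\circ\alpha=\varphi$. Let $\mathfrak A_m$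 be the norm closure of the linear span of all words of positive length of the form $a_{i_1}^\dagger\cdots a_{i_m}^\dagger a_{j_1}\cdots a_{j_n}$ with $i_1<\cdots<i_m$, $j_1>\cdots>j_n$, $m+n\ge1$, or of the form $a_{i_1}^\dagger\cdots a_{i_m}^\dagger a_ka_k^\dagger a_{j_1}\cdots a_{j_n}$ with $m,n\ge0$, $i_1<\cdots<i_m<k$ and $k>j_1>\cdots>j_n$. One has $\mathfrak R_m=\mathfrak A_m+\mathbb CI$ and $I\notin\mathfrak A_m$. The vacuum state is $\omega(Y)=\langle Y\Omega,\Omega\rangle$, $Y\in\mathfrak R_m$, and the state at infinity is $\omega_\infty(X+cI)=c$ for $X\in\mathfrak A_m$, $c\in\mathbb C$. *)

theory Defs
  imports "HOL-Analysis.Analysis"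
begin

section \<open>The monotone Fock space\<close>

text \<open>
  The strictly increasing tuples of length \<open>k\<close>, for all \<open>k \<ge> 0\<close> at once, are the strictly sorted
  integer lists.  The Hilbert sum of the spaces \<open>\<ell>\<^sup>2(I\<^sub>k)\<close> is \<open>\<ell>\<^sup>2\<close> of the disjoint union of the
  \<open>I\<^sub>k\<close>; its elements are represented by their coordinate functions on all lists, vanishing on the
  lists that are not strictly increasing.
\<close>

abbreviation strict_incr :: "int list \<Rightarrow> bool"
  where "strict_incr \<equiv> sorted_wrt (<)"

abbreviation strict_decr :: "int list \<Rightarrow> bool"
  where "strict_decr \<equiv> sorted_wrt (>)"

definition square_summable :: "('a \<Rightarrow> complex) \<Rightarrow> bool"
  where "square_summable f \<longleftrightarrow> (\<lambda>x. (cmod (f x))\<^sup>2) summable_on UNIV"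

lemma square_summable_0: "square_summable (\<lambda>_. 0)"
  by (simp add: square_summable_def)

lemma square_summable_comparison:
  assumes "square_summable f" "\<And>x. (cmod (g x))\<^sup>2 \<le> C * (cmod (f x))\<^sup>2"
  shows "square_summable g"
  unfolding square_summable_def
proof (rule summable_on_comparison_test)
  show "(\<lambda>x. C * (cmod (f x))\<^sup>2) summable_on UNIV"
    using assms(1) unfolding square_summable_def by (rule summable_on_cmult_right)
qed (use assms(2) in auto)

lemma square_summable_add:
  assumes "square_summable f" "square_summable g"
  shows "square_summable (\<lambda>x. f x + g x)"
  unfolding square_summable_def
proof (rule summable_on_comparison_test)
  show "(\<lambda>x. 2 * ((cmod (f x))\<^sup>2 + (cmod (g x))\<^sup>2)) summable_on UNIV"
    using assms unfolding square_summable_def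
    by (intro summable_on_cmult_right summable_on_add)
  fix x
  have "(cmod (f x + g x))\<^sup>2 \<le> (cmod (f x) + cmod (g x))\<^sup>2"
    by (intro power_mono norm_triangle_ineq) auto
  also have "\<dots> \<le> 2 * ((cmod (f x))\<^sup>2 + (cmod (g x))\<^sup>2)"
    using sum_squares_bound[of "cmod (f x)" "cmod (g x)"] by (simp add: power2_sum)
  finally show "(cmod (f x + g x))\<^sup>2 \<le> 2 * ((cmod (f x))\<^sup>2 + (cmod (g x))\<^sup>2)" .
qed auto

lemma square_summable_cmult:
  assumes "square_summable f"
  shows "square_summable (\<lambda>x. c * f x)"
  by (rule square_summable_comparison[OF assms, of _ "(cmod c)\<^sup>2"])
     (simp add: norm_mult power_mult_distrib)

lemma square_summable_mult_cnj:
  assumes "square_summable f" "square_summable g"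
  shows "(\<lambda>x. f x * cnj (g x)) summable_on UNIV"
proof (rule abs_summable_summable, rule summable_on_comparison_test)
  show "(\<lambda>x. (cmod (f x))\<^sup>2 + (cmod (g x))\<^sup>2) summable_on UNIV"
    using assms unfolding square_summable_def by (intro summable_on_add)
  fix x
  show "norm (f x * cnj (g x)) \<le> (cmod (f x))\<^sup>2 + (cmod (g x))\<^sup>2"
    using sum_squares_bound[of "cmod (f x)" "cmod (g x)"]
      mult_nonneg_nonneg[OF norm_ge_zero norm_ge_zero, of "f x" "g x"]
    unfolding norm_mult complex_mod_cnj by linarith
qed auto

lemma square_summable_inj:
  assumes f: "square_summable f" and h: "inj_on h A"
  shows "square_summable (\<lambda>x. if x \<in> A then f (h x) else 0)" (is "square_summable ?g")
    and "infsum (\<lambda>x. (cmod (if x \<in> A then f (h x) else 0))\<^sup>2) UNIV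
           \<le> infsum (\<lambda>x. (cmod (f x))\<^sup>2) UNIV"
proof -
  let ?F = "\<lambda>x. (cmod (f x))\<^sup>2"
  have s: "?F summable_on UNIV"
    using f by (simp add: square_summable_def)
  have sh: "?F summable_on (h ` A)"
    by (rule summable_on_subset_banach[OF s]) simp
  then have "(?F \<circ> h) summable_on A"
    using summable_on_reindex[OF h] by blast
  then have "(\<lambda>x. (cmod (?g x))\<^sup>2) summable_on UNIV"
    by (subst summable_on_cong_neutral[where T = A and g = "?F \<circ> h"]) auto
  then show "square_summable ?g"
    by (simp add: square_summable_def)
  have "infsum (\<lambda>x. (cmod (?g x))\<^sup>2) UNIV = infsum (?F \<circ> h) A"
    by (rule infsum_cong_neutral) auto
  also have "\<dots> = infsum ?F (h ` A)"
    using infsum_reindex[OF h, of ?F] by simp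
  also have "\<dots> \<le> infsum ?F UNIV"
    by (rule infsum_mono2[OF sh s]) auto
  finally show "infsum (\<lambda>x. (cmod (?g x))\<^sup>2) UNIV \<le> infsum ?F UNIV" .
qed

typedef fock = "{f :: int list \<Rightarrow> complex. (\<forall>xs. \<not> strict_incr xs \<longrightarrow> f xs = 0) \<and> square_summable f}"
  morphisms coord Abs_fock
  by (rule exI[of _ "\<lambda>_. 0"]) (auto simp: square_summable_0)

setup_lifting type_definition_fock

lemma square_summable_coord: "square_summable (coord f)"
  by transfer simp

lemma fock_eqI: "(\<And>xs. coord f xs = coord g xs) \<Longrightarrow> f = g"
  by transfer auto

lift_definition scaleC :: "complex \<Rightarrow> fock \<Rightarrow> fock" (infixr \<open>*\<^sub>C\<close> 75)
  is "\<lambda>c f xs. c * f xs"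
  by (auto intro: square_summable_cmult)

text \<open>The inner product is linear in the first argument.\<close>

definition cinner :: "fock \<Rightarrow> fock \<Rightarrow> complex"
  where "cinner f g = (\<Sum>\<^sub>\<infinity>xs. coord f xs * cnj (coord g xs))"

lift_definition basis :: "int list \<Rightarrow> fock"
  is "\<lambda>ys xs. if xs = ys \<and> strict_incr ys then 1 else 0"
proof -
  fix ys :: "int list"
  have "(\<lambda>xs. (cmod (if xs = ys \<and> strict_incr ys then 1 else 0))\<^sup>2) summable_on UNIV \<longleftrightarrow>
        (\<lambda>xs. (cmod (if xs = ys \<and> strict_incr ys then 1 else 0))\<^sup>2) summable_on {ys}"
    by (rule summable_on_cong_neutral) auto
  then show "(\<forall>xs. \<not> strict_incr xs \<longrightarrow> (if xs = ys \<and> strict_incr ys then 1 else 0) = 0) \<and>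
        square_summable (\<lambda>xs. if xs = ys \<and> strict_incr ys then 1 else 0)"
    by (auto simp: square_summable_def)
qed

definition vacuum :: fock  (\<open>\<Omega>\<close>)
  where "\<Omega> = basis []"

text \<open>
  The real inner product \<open>Re \<langle>f, g\<rangle>\<close> induces the Hilbert space norm; it gives access to
  the library's bounded operators, operator norm and closures.
\<close>

instantiation fock :: real_inner
begin

lift_definition zero_fock :: fock is "\<lambda>_. 0"
  by (simp add: square_summable_0)

lift_definition plus_fock :: "fock \<Rightarrow> fock \<Rightarrow> fock" is "\<lambda>f g xs. f xs + g xs"
  by (auto intro: square_summable_add)

lift_definition scaleR_fock :: "real \<Rightarrow> fock \<Rightarrow> fock" is "\<lambda>r f xs. of_real r * f xs"
  by (auto intro: square_summable_cmult)

lift_definition uminus_fock :: "fock \<Rightarrow> fock" is "\<lambda>f xs. - f xs"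
  by (auto simp: square_summable_def)

definition minus_fock :: "fock \<Rightarrow> fock \<Rightarrow> fock"
  where "f - g = f + - (g :: fock)"

definition inner_fock :: "fock \<Rightarrow> fock \<Rightarrow> real"
  where "inner_fock f g = Re (cinner f g)"

definition norm_fock :: "fock \<Rightarrow> real"
  where "norm_fock f = sqrt (inner f f)"

definition dist_fock :: "fock \<Rightarrow> fock \<Rightarrow> real"
  where "dist_fock f g = norm (f - g)"

definition sgn_fock :: "fock \<Rightarrow> fock"
  where "sgn_fock f = inverse (norm f) *\<^sub>R f"

definition uniformity_fock :: "(fock \<times> fock) filter"
  where "uniformity_fock = (INF e\<in>{0 <..}. principal {(x, y). dist x y < e})"

definition open_fock :: "fock set \<Rightarrow> bool"
  where "open_fock S = (\<forall>x\<in>S. \<forall>\<^sub>F (x', y) in uniformity. x' = x \<longrightarrow> y \<in> S)"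

lemma inner_fock_self: "inner f f = (\<Sum>\<^sub>\<infinity>xs. (cmod (coord f xs))\<^sup>2)"
proof -
  have "inner f f = (\<Sum>\<^sub>\<infinity>xs. Re (coord f xs * cnj (coord f xs)))"
    unfolding inner_fock_def cinner_def
    by (rule infsum_Re[symmetric]) (intro square_summable_mult_cnj square_summable_coord)
  then show ?thesis
    by (simp add: complex_mult_cnj cmod_power2)
qed

instance
proof
  fix f g h :: fock and r s :: real
  show "f + g + h = f + (g + h)" by transfer (simp add: add.assoc)
  show "f + g = g + f" by transfer (simp add: add.commute)
  show "0 + f = f" by transfer simp
  show "- f + f = 0" by transfer simp
  show "f - g = f + - g" by (rule minus_fock_def)
  show "r *\<^sub>R (f + g) = r *\<^sub>R f + r *\<^sub>R g" by transfer (simp add: algebra_simps)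
  show "(r + s) *\<^sub>R f = r *\<^sub>R f + s *\<^sub>R f" by transfer (simp add: algebra_simps)
  show "r *\<^sub>R s *\<^sub>R f = (r * s) *\<^sub>R f" by transfer (simp add: algebra_simps)
  show "1 *\<^sub>R f = f" by transfer simp
  show "inner f g = inner g f"
  proof -
    have "cinner f g = infsum (\<lambda>xs. cnj (coord g xs * cnj (coord f xs))) UNIV"
      by (simp add: cinner_def mult.commute)
    also have "\<dots> = cnj (cinner g f)"
      unfolding cinner_def by (rule infsum_cnj)
    finally show ?thesis by (simp add: inner_fock_def)
  qed
  show "inner (f + g) h = inner f h + inner g h"
  proof -
    have "cinner (f + g) h
        = infsum (\<lambda>xs. coord f xs * cnj (coord h xs) + coord g xs * cnj (coord h xs)) UNIV"
      by (simp add: cinner_def plus_fock.rep_eq algebra_simps)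
    also have "\<dots> = cinner f h + cinner g h"
      unfolding cinner_def
      by (intro infsum_add square_summable_mult_cnj square_summable_coord)
    finally show ?thesis by (simp add: inner_fock_def)
  qed
  show "inner (r *\<^sub>R f) g = r * inner f g"
    by (simp add: inner_fock_def cinner_def scaleR_fock.rep_eq mult.assoc infsum_cmult_right')
  show "0 \<le> inner f f"
    unfolding inner_fock_self by (rule infsum_nonneg) simp
  show "inner f f = 0 \<longleftrightarrow> f = 0"
  proof
    assume "inner f f = 0"
    then have "(\<Sum>\<^sub>\<infinity>xs. (cmod (coord f xs))\<^sup>2) = 0" by (simp add: inner_fock_self)
    then have "(cmod (coord f xs))\<^sup>2 = 0" for xs
      using square_summable_coord[of f, unfolded square_summable_def]
      by (intro nonneg_infsum_le_0D[where A = UNIV]) auto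
    then show "f = 0" by (intro fock_eqI) (simp add: zero_fock.rep_eq)
  qed (simp add: inner_fock_self zero_fock.rep_eq)
qed (rule norm_fock_def dist_fock_def sgn_fock_def uniformity_fock_def open_fock_def)+

end

lemma norm_fock_square: "(norm f)\<^sup>2 = (\<Sum>\<^sub>\<infinity>xs. (cmod (coord f xs))\<^sup>2)" for f :: fock
  by (simp add: power2_norm_eq_inner inner_fock_self)

lemma norm_coord_le: "cmod (coord f xs) \<le> norm f"
proof -
  have "(cmod (coord f xs))\<^sup>2 = infsum (\<lambda>ys. (cmod (coord f ys))\<^sup>2) {xs}"
    by simp
  also have "\<dots> \<le> (norm f)\<^sup>2"
    unfolding norm_fock_square
    using square_summable_coord[of f, unfolded square_summable_def]
    by (intro infsum_mono2) auto
  finally show ?thesis by (rule power2_le_imp_le) simp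
qed

lemma coord_diff: "coord (f - g) xs = coord f xs - coord g xs"
  unfolding minus_fock_def plus_fock.rep_eq uminus_fock.rep_eq by simp

lemma sum_coord_le: "finite F \<Longrightarrow> (\<Sum>xs\<in>F. (cmod (coord f xs))\<^sup>2) \<le> (norm f)\<^sup>2"
  unfolding norm_fock_square
  using square_summable_coord[of f, unfolded square_summable_def]
  by (intro finite_sum_le_infsum) auto

instance fock :: banach
proof
  fix X :: "nat \<Rightarrow> fock"
  assume X: "Cauchy X"
  have "Cauchy (\<lambda>n. coord (X n) xs)" for xs
  proof (rule metric_CauchyI)
    fix e :: real assume "e > 0"
    then obtain N where N: "\<And>m n. m \<ge> N \<Longrightarrow> n \<ge> N \<Longrightarrow> dist (X m) (X n) < e"
      using metric_CauchyD[OF X] by blast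
    have le: "dist (coord (X m) xs) (coord (X n) xs) \<le> dist (X m) (X n)" for m n
      using norm_coord_le[of "X m - X n" xs] by (simp add: dist_norm coord_diff)
    show "\<exists>M. \<forall>m\<ge>M. \<forall>n\<ge>M. dist (coord (X m) xs) (coord (X n) xs) < e"
      by (intro exI[of _ N] allI impI le_less_trans[OF le N])
  qed
  then have "\<exists>l. (\<lambda>n. coord (X n) xs) \<longlonglongrightarrow> l" for xs
    by (simp add: Cauchy_convergent_iff convergent_def)
  then obtain g where g: "\<And>xs. (\<lambda>n. coord (X n) xs) \<longlonglongrightarrow> g xs"
    by metis
  have *: "(\<Sum>xs\<in>F. (cmod (coord (X n) xs - g xs))\<^sup>2) \<le> e\<^sup>2"
    if "finite F" "n \<ge> N" "e > 0" and N: "\<And>m n. m \<ge> N \<Longrightarrow> n \<ge> N \<Longrightarrow> dist (X m) (X n) < e"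
    for F n N and e :: real
  proof (rule LIMSEQ_le_const2)
    show "(\<lambda>m. \<Sum>xs\<in>F. (cmod (coord (X n) xs - coord (X m) xs))\<^sup>2)
        \<longlonglongrightarrow> (\<Sum>xs\<in>F. (cmod (coord (X n) xs - g xs))\<^sup>2)"
      by (intro tendsto_intros g)
    have "(\<Sum>xs\<in>F. (cmod (coord (X n) xs - coord (X m) xs))\<^sup>2) \<le> e\<^sup>2" if "m \<ge> N" for m
    proof -
      have "(\<Sum>xs\<in>F. (cmod (coord (X n) xs - coord (X m) xs))\<^sup>2) \<le> (norm (X n - X m))\<^sup>2"
        using sum_coord_le[OF \<open>finite F\<close>, of "X n - X m"] by (simp add: coord_diff)
      also have "\<dots> \<le> e\<^sup>2"
        using N[OF \<open>n \<ge> N\<close> that] by (intro power_mono) (auto simp: dist_norm)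
      finally show ?thesis .
    qed
    then show "\<exists>M. \<forall>m\<ge>M. (\<Sum>xs\<in>F. (cmod (coord (X n) xs - coord (X m) xs))\<^sup>2) \<le> e\<^sup>2"
      by blast
  qed
  have sq: "square_summable (\<lambda>xs. coord (X n) xs - g xs)"
    if "n \<ge> N" "e > 0" "\<And>m n. m \<ge> N \<Longrightarrow> n \<ge> N \<Longrightarrow> dist (X m) (X n) < e" for n N and e :: real
    unfolding square_summable_def
  proof (rule nonneg_bdd_above_summable_on)
    show "bdd_above (sum (\<lambda>xs. (cmod (coord (X n) xs - g xs))\<^sup>2) ` {F. F \<subseteq> UNIV \<and> finite F})"
      using *[OF _ that] by (intro bdd_aboveI2[of _ _ "e\<^sup>2"]) blast
  qed simp
  obtain N1 where N1: "\<And>m n. m \<ge> N1 \<Longrightarrow> n \<ge> N1 \<Longrightarrow> dist (X m) (X n) < 1"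
    using metric_CauchyD[OF X, of 1] by auto
  have "square_summable (\<lambda>xs. coord (X N1) xs + (-1) * (coord (X N1) xs - g xs))"
    by (intro square_summable_add square_summable_cmult square_summable_coord
        sq[OF order_refl zero_less_one N1])
  then have "square_summable g"
    by simp
  moreover have "g xs = 0" if "\<not> strict_incr xs" for xs
  proof -
    have "coord (X n) xs = 0" for n
      using coord[of "X n"] that by simp
    then show ?thesis
      using g[of xs] by (simp add: LIMSEQ_const_iff)
  qed
  ultimately have G: "coord (Abs_fock g) = g"
    by (intro Abs_fock_inverse) auto
  have "X \<longlonglongrightarrow> Abs_fock g"
  proof (rule metric_LIMSEQ_I)
    fix r :: real assume "r > 0"
    define e where "e = r / 2"
    have e: "e > 0" "e < r" using \<open>r > 0\<close> by (auto simp: e_def)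
    obtain N where N: "\<And>m n. m \<ge> N \<Longrightarrow> n \<ge> N \<Longrightarrow> dist (X m) (X n) < e"
      using metric_CauchyD[OF X \<open>e > 0\<close>] by blast
    have "dist (X n) (Abs_fock g) < r" if "n \<ge> N" for n
    proof -
      have "(norm (X n - Abs_fock g))\<^sup>2 = (\<Sum>\<^sub>\<infinity>xs. (cmod (coord (X n) xs - g xs))\<^sup>2)"
        by (simp add: norm_fock_square coord_diff G)
      also have "\<dots> \<le> e\<^sup>2"
      proof (rule infsum_le_finite_sums)
        show "(\<lambda>xs. (cmod (coord (X n) xs - g xs))\<^sup>2) summable_on UNIV"
          using sq[OF that \<open>e > 0\<close> N] by (simp add: square_summable_def)
        show "(\<Sum>xs\<in>F. (cmod (coord (X n) xs - g xs))\<^sup>2) \<le> e\<^sup>2" if F: "finite F" for F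
          by (rule *[OF F \<open>n \<ge> N\<close> \<open>e > 0\<close> N])
      qed
      finally have "norm (X n - Abs_fock g) \<le> e"
        by (rule power2_le_imp_le) (use e in simp)
      then show ?thesis
        using e by (simp add: dist_norm)
    qed
    then show "\<exists>N. \<forall>n\<ge>N. dist (X n) (Abs_fock g) < r" by blast
  qed
  then show "convergent X"
    by (rule convergentI)
qed

lemma norm_scaleC: "norm (c *\<^sub>C f) = cmod c * norm f"
proof -
  have "(norm (c *\<^sub>C f))\<^sup>2 = (cmod c * norm f)\<^sup>2"
    by (simp add: norm_fock_square power_mult_distrib scaleC.rep_eq norm_mult infsum_cmult_right')
  then show ?thesis by (simp add: power2_eq_iff_nonneg)
qed

lemma cinner_basis: "strict_incr xs \<Longrightarrow> cinner f (basis xs) = coord f xs"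
proof -
  assume "strict_incr xs"
  then have "cinner f (basis xs) = infsum (\<lambda>ys. coord f ys * cnj (coord (basis xs) ys)) {xs}"
    unfolding cinner_def by (intro infsum_cong_neutral) (auto simp: basis.rep_eq)
  with \<open>strict_incr xs\<close> show ?thesis by (simp add: basis.rep_eq)
qed


section \<open>Operators\<close>

text \<open>
  Operators are elements of the library type of bounded real-linear maps; complex linearity is
  the predicate \<open>complex_linear\<close> below.
\<close>

type_synonym fock_op = "fock \<Rightarrow>\<^sub>L fock"

definition complex_linear :: "fock_op \<Rightarrow> bool"
  where "complex_linear T \<longleftrightarrow> (\<forall>c f. T (c *\<^sub>C f) = c *\<^sub>C T f)"

definition is_adjoint :: "fock_op \<Rightarrow> fock_op \<Rightarrow> bool"
  where "is_adjoint S T \<longleftrightarrow> (\<forall>f g. cinner (S f) g = cinner f (T g))"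

lift_definition scalar_op :: "complex \<Rightarrow> fock_op" is scaleC
proof
  fix c :: complex and f g :: fock and r :: real
  show "c *\<^sub>C (f + g) = c *\<^sub>C f + c *\<^sub>C g" by transfer (simp add: algebra_simps)
  show "c *\<^sub>C (r *\<^sub>R f) = r *\<^sub>R (c *\<^sub>C f)" by transfer (simp add: algebra_simps)
  show "\<exists>K. \<forall>f. norm (c *\<^sub>C f) \<le> norm f * K"
    by (intro exI[of _ "cmod c"]) (simp add: norm_scaleC mult.commute)
qed

definition op_scaleC :: "complex \<Rightarrow> fock_op \<Rightarrow> fock_op"
  where "op_scaleC c T = scalar_op c o\<^sub>L T"

lemma op_scaleC_apply [simp]: "op_scaleC c T f = c *\<^sub>C T f"
  by (simp add: op_scaleC_def scalar_op.rep_eq)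

lemma vector_space_op_scaleC: "vector_space op_scaleC"
  by unfold_locales
     (rule blinfun_eqI, simp add: blinfun.add_left, transfer, simp add: algebra_simps)+

lemma bounded_linear_partial_inj:
  fixes h :: "int list \<Rightarrow> int list"
  assumes T: "\<And>f xs. coord (T f) xs = (if xs \<in> A then coord f (h xs) else 0)"
    and h: "inj_on h A"
  shows "bounded_linear T"
proof
  fix f g :: fock and r :: real
  show "T (f + g) = T f + T g"
    by (rule fock_eqI) (simp add: T plus_fock.rep_eq)
  show "T (r *\<^sub>R f) = r *\<^sub>R T f"
    by (rule fock_eqI) (simp add: T scaleR_fock.rep_eq)
  show "\<exists>K. \<forall>f. norm (T f) \<le> norm f * K"
  proof (intro exI[of _ 1] allI)
    fix f
    have "(norm (T f))\<^sup>2 \<le> (norm f)\<^sup>2"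
      using square_summable_inj(2)[OF square_summable_coord h, of f]
      by (simp add: norm_fock_square T)
    then have "norm (T f) \<le> norm f" by (rule power2_le_imp_le) simp
    then show "norm (T f) \<le> norm f * 1" by simp
  qed
qed

text \<open>
  Creation, annihilation and shift operators are given by their coordinates; the lemmas
  \<open>create_basis\<close>, \<open>annihilate_basis\<close> and \<open>shift_basis\<close> give the action on the canonical
  basis.
\<close>

lemma inj_on_tl: "inj_on tl {xs. strict_incr xs \<and> xs \<noteq> [] \<and> hd xs = i}"
  by (rule inj_onI) (auto intro: list.expand)

lemma inj_on_Cons': "inj_on ((#) i) B"
  by (auto intro: inj_onI)

lemma strict_incr_map_add: "strict_incr (map (\<lambda>j. j + k) xs) \<longleftrightarrow> strict_incr xs"
  by (simp add: sorted_wrt_map)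

lemma strict_incr_map_diff: "strict_incr (map (\<lambda>j. j - k) xs) \<longleftrightarrow> strict_incr xs"
  by (simp add: sorted_wrt_map)

lemma inj_map_add: "inj_on (map (\<lambda>j. j + k)) B" for k :: int
  by (rule inj_on_subset[of _ UNIV]) (auto intro: injI)

lemma inj_map_diff: "inj_on (map (\<lambda>j. j - k)) B" for k :: int
  by (rule inj_on_subset[of _ UNIV]) (auto intro: injI)

lift_definition create_fun :: "int \<Rightarrow> fock \<Rightarrow> fock"
  is "\<lambda>i f xs. if strict_incr xs \<and> xs \<noteq> [] \<and> hd xs = i then f (tl xs) else 0"
  subgoal for i f
    using square_summable_inj(1)[of f, OF _ inj_on_tl[of i]] by simp
  done

lift_definition create :: "int \<Rightarrow> fock_op" is create_fun
  by (rule bounded_linear_partial_inj[OF _ inj_on_tl]) (simp add: create_fun.rep_eq)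

lift_definition annihilate_fun :: "int \<Rightarrow> fock \<Rightarrow> fock"
  is "\<lambda>i f xs. if strict_incr (i # xs) then f (i # xs) else 0"
  subgoal for i f
    using square_summable_inj(1)[of f, OF _ inj_on_Cons'[of i "{xs. strict_incr (i # xs)}"]]
    by simp
  done

lift_definition annihilate :: "int \<Rightarrow> fock_op" is annihilate_fun
  subgoal for i
    by (rule bounded_linear_partial_inj[OF _ inj_on_Cons'[of i "{xs. strict_incr (i # xs)}"]])
       (simp add: annihilate_fun.rep_eq)
  done

lift_definition shift_fun :: "int \<Rightarrow> fock \<Rightarrow> fock"
  is "\<lambda>k f xs. f (map (\<lambda>j. j - k) xs)"
  subgoal for k f
    using square_summable_inj(1)[of f, OF _ inj_map_diff[of k UNIV]]
    by (simp add: strict_incr_map_diff)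
  done

lift_definition shift :: "int \<Rightarrow> fock_op" is shift_fun
  subgoal for k
    by (rule bounded_linear_partial_inj[OF _ inj_map_diff[of k UNIV]])
       (simp add: shift_fun.rep_eq)
  done

lemma coord_create:
  "coord (create i f) xs = (if strict_incr xs \<and> xs \<noteq> [] \<and> hd xs = i then coord f (tl xs) else 0)"
  by (simp add: create.rep_eq create_fun.rep_eq)

lemma coord_annihilate:
  "coord (annihilate i f) xs = (if strict_incr (i # xs) then coord f (i # xs) else 0)"
  by (simp add: annihilate.rep_eq annihilate_fun.rep_eq)

lemma coord_shift: "coord (shift k f) xs = coord f (map (\<lambda>j. j - k) xs)"
  by (simp add: shift.rep_eq shift_fun.rep_eq)

lemma create_basis:
  assumes "strict_incr xs"
  shows "create i (basis xs) = (if xs = [] \<or> i < hd xs then basis (i # xs) else 0)"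
proof (rule fock_eqI)
  fix ys
  have "strict_incr (i # xs) \<longleftrightarrow> xs = [] \<or> i < hd xs"
    using assms by (cases xs) (auto intro: less_trans)
  then show "coord (create i (basis xs)) ys
      = coord (if xs = [] \<or> i < hd xs then basis (i # xs) else 0) ys"
    using assms by (cases ys) (auto simp: coord_create basis.rep_eq zero_fock.rep_eq)
qed

lemma annihilate_basis:
  assumes "strict_incr xs"
  shows "annihilate i (basis xs) = (if xs \<noteq> [] \<and> i = hd xs then basis (tl xs) else 0)"
proof (rule fock_eqI)
  fix ys
  show "coord (annihilate i (basis xs)) ys
      = coord (if xs \<noteq> [] \<and> i = hd xs then basis (tl xs) else 0) ys"
    using assms by (cases xs) (auto simp: coord_annihilate basis.rep_eq zero_fock.rep_eq)
qed

lemma map_shift_eq: "map (\<lambda>j. j - k) ys = xs \<longleftrightarrow> ys = map (\<lambda>j. j + k) xs" for k :: int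
  by (auto simp: o_def)

lemma shift_basis: "shift k (basis xs) = basis (map (\<lambda>j. j + k) xs)"
  by (rule fock_eqI) (auto simp: coord_shift basis.rep_eq map_shift_eq strict_incr_map_add)

lemma is_adjoint_create: "is_adjoint (create i) (annihilate i)"
  unfolding is_adjoint_def
proof (intro allI)
  fix f g
  let ?A = "{xs. strict_incr (i # xs)}"
  have "cinner (create i f) g
      = infsum (\<lambda>xs. coord f (tl xs) * cnj (coord g xs)) ((#) i ` ?A)"
    unfolding cinner_def
    by (rule infsum_cong_neutral) (auto simp: coord_create image_iff neq_Nil_conv)
  also have "\<dots> = infsum ((\<lambda>xs. coord f (tl xs) * cnj (coord g xs)) \<circ> (#) i) ?A"
    by (rule infsum_reindex[OF inj_on_Cons'])
  also have "\<dots> = cinner f (annihilate i g)"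
    unfolding cinner_def
    by (rule infsum_cong_neutral) (auto simp: coord_annihilate)
  finally show "cinner (create i f) g = cinner f (annihilate i g)" .
qed

lemma shift_inverse: "shift k o\<^sub>L shift (- k) = id_blinfun"
  by (rule blinfun_eqI, rule fock_eqI) (simp add: coord_shift o_def)

lemma is_adjoint_shift: "is_adjoint (shift k) (shift (- k))"
  unfolding is_adjoint_def
proof (intro allI)
  fix f g
  have "cinner f (shift (- k) g)
      = infsum ((\<lambda>xs. coord f (map (\<lambda>j. j - k) xs) * cnj (coord g xs)) \<circ> map (\<lambda>j. j + k)) UNIV"
    by (simp add: cinner_def coord_shift o_def)
  also have "\<dots> = infsum (\<lambda>xs. coord f (map (\<lambda>j. j - k) xs) * cnj (coord g xs))
                      (range (map (\<lambda>j. j + k)))"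
    using inj_map_add[of k UNIV] by (subst infsum_reindex) auto
  also have "range (map (\<lambda>j. j + k)) = UNIV"
  proof -
    have "ys = map (\<lambda>j. j + k) (map (\<lambda>j. j - k) ys)" for ys :: "int list"
      by (simp add: o_def)
    then show ?thesis by blast
  qed
  finally show "cinner (shift k f) g = cinner f (shift (- k) g)"
    by (simp add: cinner_def coord_shift)
qed

definition shift_aut :: "fock_op \<Rightarrow> fock_op"
  where "shift_aut T = shift 1 o\<^sub>L T o\<^sub>L shift (- 1)"

lemma shift_aut_annihilate: "shift_aut (annihilate i) = annihilate (i + 1)"
proof (rule blinfun_eqI, rule fock_eqI)
  fix f xs
  show "coord (shift_aut (annihilate i) f) xs = coord (annihilate (i + 1) f) xs"
    using strict_incr_map_add[of "- 1" "(i + 1) # xs"]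
    by (simp add: shift_aut_def coord_shift coord_annihilate o_def)
qed


section \<open>The monotone C*-algebra\<close>

definition unital_cstar_subalgebra :: "fock_op set \<Rightarrow> bool"
  where "unital_cstar_subalgebra A \<longleftrightarrow>
    closed A \<and>
    id_blinfun \<in> A \<and>
    (\<forall>T\<in>A. complex_linear T) \<and>
    (\<forall>S\<in>A. \<forall>T\<in>A. S + T \<in> A) \<and>
    (\<forall>c. \<forall>T\<in>A. op_scaleC c T \<in> A) \<and>
    (\<forall>S\<in>A. \<forall>T\<in>A. S o\<^sub>L T \<in> A) \<and>
    (\<forall>T\<in>A. \<exists>S\<in>A. is_adjoint S T)"

definition monotone_algebra :: "fock_op set"  (\<open>\<RR>\<^sub>m\<close>)
  where "\<RR>\<^sub>m = unital_cstar_subalgebra hull range annihilate"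

definition op_prod :: "fock_op list \<Rightarrow> fock_op"
  where "op_prod Ts = foldr (o\<^sub>L) Ts id_blinfun"

definition lambda_words :: "fock_op set"
  where "lambda_words =
    {op_prod (map create is @ map annihilate js) | is js.
       strict_incr is \<and> strict_decr js \<and> length is + length js \<ge> 1}"

definition pi_words :: "fock_op set"
  where "pi_words =
    {op_prod (map create is @ [annihilate k, create k] @ map annihilate js) | is k js.
       strict_incr (is @ [k]) \<and> strict_decr (k # js)}"

definition monotone_ideal :: "fock_op set"  (\<open>\<AA>\<^sub>m\<close>)
  where "\<AA>\<^sub>m = closure (module.span op_scaleC (lambda_words \<union> pi_words))"


section \<open>States\<close>

text \<open>
  States are \<open>undefined\<close> outside the algebra, so that equality of states is equality on the algebra.
\<close>

definition states :: "fock_op set \<Rightarrow> (fock_op \<Rightarrow> complex) set"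
  where "states A = {\<phi> \<in> extensional A.
    (\<forall>S\<in>A. \<forall>T\<in>A. \<phi> (S + T) = \<phi> S + \<phi> T) \<and>
    (\<forall>c. \<forall>T\<in>A. \<phi> (op_scaleC c T) = c * \<phi> T) \<and>
    (\<forall>S\<in>A. \<forall>T\<in>A. is_adjoint S T \<longrightarrow> \<phi> (S o\<^sub>L T) \<in> \<real>\<^sub>\<ge>\<^sub>0) \<and>
    \<phi> id_blinfun = 1}"

definition shift_invariant_states :: "(fock_op \<Rightarrow> complex) set"
  where "shift_invariant_states = {\<phi> \<in> states \<RR>\<^sub>m. \<forall>T\<in>\<RR>\<^sub>m. \<phi> (shift_aut T) = \<phi> T}"

definition vacuum_state :: "fock_op \<Rightarrow> complex"  (\<open>\<omega>\<close>)
  where "\<omega> = (\<lambda>T\<in>\<RR>\<^sub>m. cinner (blinfun_apply T \<Omega>) \<Omega>)"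

text \<open>The scalar is unique because \<open>\<RR>\<^sub>m = \<AA>\<^sub>m + \<complex>I\<close> and \<open>I \<notin> \<AA>\<^sub>m\<close>.\<close>

definition state_at_infinity :: "fock_op \<Rightarrow> complex"  (\<open>\<omega>\<^sub>\<infinity>\<close>)
  where "\<omega>\<^sub>\<infinity> = (\<lambda>T\<in>\<RR>\<^sub>m. THE c. \<exists>X\<in>\<AA>\<^sub>m. T = X + op_scaleC c id_blinfun)"

text \<open>
  The weak-* topology is pointwise convergence on \<open>A\<close>.  The points of this product space are
  all functions in \<open>extensional A\<close>; on states it induces the usual weak-* topology.
\<close>

definition weak_star_topology :: "fock_op set \<Rightarrow> (fock_op \<Rightarrow> complex) topology"
  where "weak_star_topology A = product_topology (\<lambda>_. euclidean) A"

end

(*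
  An invariant state kills every word W containing a creator on the left: its translates have
  mutually orthogonal ranges, so the sum of N of them has norm at most sqrt N, while the state
  takes the value N phi(W) on it.  Taking adjoints, it kills all words except the projections
  a_k a_k^*, on which it has a constant value gamma in [0,1].  By continuity the state is then
  (1 - gamma) omega_infinity + gamma omega.

  The vector states of e_(-n) tend to 0 on words, hence on the ideal, as n tends to infinity.
  Their limit on the unitization of the ideal is omega_infinity, and it yields the uniqueness of
  the scalar part, the closedness of the unitization, and the positivity of omega_infinity.
*)
theory Submission
  imports Defs
begin

section \<open>The sesquilinear form and adjoints\<close>

text \<open>A state is given only by linearity, normalization and positivity on products
  \<open>S o\<^sub>L T\<close> with \<open>S\<close> adjoint to \<open>T\<close>. Hermiticity and
  norm continuity, both essential below, have to be extracted from positivity, which calls for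
  square roots of \<open>id_blinfun - H\<close> that stay inside the algebra. The general bound so
  obtained carries a factor 2, harmless against the growth of N over sqrt N.

  The algebra is a hull, with no description of its elements, so it has to be identified with the
  ideal plus scalars before words can determine a state. This makes the product of two words the
  main computation. Describing both kinds of words by one family that exchanges prefixes of lists
  reduces it to comparing two prefixes.

  The direction of escape matters: for n tending to plus infinity the vectors e_(n) are eventually
  fixed by each projection a_k a_k^*, and their vector states tend to omega instead.\<close>

lemma cinner_eq_Complex: "cinner f g = Complex (inner f g) (inner f (scalar_op \<i> g))"
proof -
  have "cinner f (\<i> *\<^sub>C g) = (\<Sum>\<^sub>\<infinity>xs. - \<i> * (coord f xs * cnj (coord g xs)))"
    by (simp add: cinner_def scaleC.rep_eq mult_ac)
  also have "\<dots> = - \<i> * cinner f g"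
    unfolding cinner_def by (rule infsum_cmult_right')
  finally have "Re (cinner f (\<i> *\<^sub>C g)) = Im (cinner f g)"
    by simp
  then show ?thesis
    by (simp add: complex_eq_iff inner_fock_def scalar_op.rep_eq)
qed

text \<open>Since Im <f, g> = Re <f, i g>, both parts of the form are real inner products, and
  everything reduces to the real Hilbert space structure. Real bilinearity suffices for the limit
  and sum rules.\<close>

lemma bounded_bilinear_cinner: "bounded_bilinear cinner"
proof
  fix f g h :: fock and r :: real
  show "cinner (f + g) h = cinner f h + cinner g h"
    by (simp add: cinner_eq_Complex complex_eq_iff inner_add_left)
  show "cinner f (g + h) = cinner f g + cinner f h"
    by (simp add: cinner_eq_Complex complex_eq_iff inner_add_right blinfun.add_right)
  show "cinner (r *\<^sub>R f) g = r *\<^sub>R cinner f g"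
    by (simp add: cinner_eq_Complex complex_eq_iff)
  show "cinner f (r *\<^sub>R g) = r *\<^sub>R cinner f g"
    by (simp add: cinner_eq_Complex complex_eq_iff blinfun.scaleR_right)
  show "\<exists>K. \<forall>f g. norm (cinner f g) \<le> norm f * norm g * K"
  \<comment> \<open>The constant 2 counts one real Cauchy-Schwarz estimate for each of the two
    parts.\<close>
  proof (intro exI[of _ 2] allI)
    fix f g
    have "norm (cinner f g) \<le> \<bar>inner f g\<bar> + \<bar>inner f (scalar_op \<i> g)\<bar>"
      unfolding cinner_eq_Complex by (rule order_trans[OF cmod_le]) simp
    also have "\<dots> \<le> norm f * norm g + norm f * norm (scalar_op \<i> g)"
      by (intro add_mono Cauchy_Schwarz_ineq2)
    finally show "norm (cinner f g) \<le> norm f * norm g * 2"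
      by (simp add: scalar_op.rep_eq norm_scaleC)
  qed
qed

interpretation cinner: bounded_bilinear cinner
  by (rule bounded_bilinear_cinner)

lemma cinner_scaleC_left: "cinner (c *\<^sub>C f) g = c * cinner f g"
  unfolding cinner_def by (simp add: scaleC.rep_eq mult.assoc infsum_cmult_right')

lemma cinner_commute: "cinner f g = cnj (cinner g f)"
proof -
  have "cinner f g = infsum (\<lambda>xs. cnj (coord g xs * cnj (coord f xs))) UNIV"
    by (simp add: cinner_def mult.commute)
  then show ?thesis
    unfolding cinner_def by (simp only: infsum_cnj)
qed

lemma cinner_scaleC_right: "cinner f (c *\<^sub>C g) = cnj c * cinner f g"
  using cinner_scaleC_left[of c g f] cinner_commute[of f g] cinner_commute[of f "c *\<^sub>C g"] by simp

lemma is_adjointD: "is_adjoint S T \<Longrightarrow> cinner (S f) g = cinner f (T g)"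
  by (simp add: is_adjoint_def)

lemma is_adjoint_sym: "is_adjoint S T \<Longrightarrow> is_adjoint T S"
  unfolding is_adjoint_def by (metis cinner_commute)

lemma is_adjoint_inner: "is_adjoint S T \<Longrightarrow> inner (S f) g = inner f (T g)"
  by (simp add: is_adjoint_def inner_fock_def)

lemma is_adjoint_id: "is_adjoint id_blinfun id_blinfun"
  by (simp add: is_adjoint_def)

lemma is_adjoint_add: "is_adjoint S T \<Longrightarrow> is_adjoint S' T' \<Longrightarrow> is_adjoint (S + S') (T + T')"
  by (simp add: is_adjoint_def blinfun.add_left cinner.add_left cinner.add_right)

lemma is_adjoint_scaleC: "is_adjoint S T \<Longrightarrow> is_adjoint (op_scaleC c S) (op_scaleC (cnj c) T)"
  by (simp add: is_adjoint_def cinner_scaleC_left cinner_scaleC_right)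

lemma is_adjoint_compose: "is_adjoint S T \<Longrightarrow> is_adjoint S' T' \<Longrightarrow> is_adjoint (S o\<^sub>L S') (T' o\<^sub>L T)"
  by (simp add: is_adjoint_def)

lemma is_adjoint_tendsto:
  assumes "S \<longlonglongrightarrow> S'" "T \<longlonglongrightarrow> T'" "\<And>n. is_adjoint (S n) (T n)"
  shows "is_adjoint S' T'"
  unfolding is_adjoint_def
proof (intro allI)
  fix f g
  have "(\<lambda>n. cinner (S n f) g) \<longlonglongrightarrow> cinner (S' f) g"
    by (intro cinner.tendsto blinfun.tendsto assms tendsto_const)
  moreover have "(\<lambda>n. cinner f (T n g)) \<longlonglongrightarrow> cinner f (T' g)"
    by (intro cinner.tendsto blinfun.tendsto assms tendsto_const)
  ultimately show "cinner (S' f) g = cinner f (T' g)"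
    using is_adjointD[OF assms(3)] LIMSEQ_unique by simp
qed

lemma is_adjoint_unique:
  assumes "is_adjoint S T" "is_adjoint S' T"
  shows "S = S'"
proof (rule blinfun_eqI)
  fix f
  have "inner (S f - S' f) (S f - S' f) = 0"
    using is_adjoint_inner[OF assms(1)] is_adjoint_inner[OF assms(2)] by (simp add: inner_diff_left)
  then show "S f = S' f" by simp
qed

text \<open>Cancel one factor \<open>norm (S f)\<close> in <Sf, Sf> = <f, TSf>. The bound carries
  Cauchy sequences over to their adjoints.\<close>

lemma is_adjoint_norm_le:
  assumes "is_adjoint S T"
  shows "norm S \<le> norm T"
proof (rule norm_blinfun_bound)
  fix f
  have "norm (S f) * norm (S f) = inner f (T (S f))"
    using is_adjoint_inner[OF assms, of f "S f"] by (simp add: power2_norm_eq_inner flip: power2_eq_square)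
  also have "\<dots> \<le> norm f * norm (T (S f))"
    by (rule norm_cauchy_schwarz)
  also have "\<dots> \<le> norm f * (norm T * norm (S f))"
    by (intro mult_left_mono norm_blinfun) simp
  finally show "norm (S f) \<le> norm T * norm f"
    by (cases "norm (S f) = 0") (auto simp: algebra_simps mult_le_cancel_left_pos)
qed simp

section \<open>Complex scalar multiples and complex linearity of operators\<close>

interpretation op: vector_space op_scaleC
  by (rule vector_space_op_scaleC)

lemma op_scaleC_of_real: "op_scaleC (of_real r) T = r *\<^sub>R T"
  by (rule blinfun_eqI, rule fock_eqI) (simp add: blinfun.scaleR_left scaleC.rep_eq scaleR_fock.rep_eq)

lemma norm_op_scaleC: "norm (op_scaleC c T) \<le> cmod c * norm T"
proof (rule norm_blinfun_bound)
  show "norm (op_scaleC c T f) \<le> cmod c * norm T * norm f" for f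
    using norm_blinfun[of T f] by (simp add: norm_scaleC mult.assoc mult_left_mono)
qed simp

lemma bounded_linear_op_scaleC: "bounded_linear (op_scaleC c)"
proof
  show "\<exists>K. \<forall>T. norm (op_scaleC c T) \<le> norm T * K"
    using norm_op_scaleC by (metis mult.commute)
qed (simp_all add: op.scale_right_distrib op_scaleC_of_real[symmetric] mult.commute)

lemma bounded_linear_op_scaleC_left: "bounded_linear (\<lambda>c. op_scaleC c T)"
proof
  show "\<exists>K. \<forall>c. norm (op_scaleC c T) \<le> norm c * K"
    using norm_op_scaleC by blast
qed (simp_all add: op.scale_left_distrib op_scaleC_of_real[symmetric] scaleR_conv_of_real)

lemma op_scaleC_compose_left: "op_scaleC c S o\<^sub>L T = op_scaleC c (S o\<^sub>L T)"
  by (rule blinfun_eqI) simp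

lemma op_scaleC_compose_right: "complex_linear S \<Longrightarrow> S o\<^sub>L op_scaleC c T = op_scaleC c (S o\<^sub>L T)"
  by (rule blinfun_eqI) (simp add: complex_linear_def)

lemma scaleC_add: "c *\<^sub>C (f + g) = c *\<^sub>C f + c *\<^sub>C g"
  by transfer (simp add: algebra_simps)

lemma scaleC_scaleC: "c *\<^sub>C d *\<^sub>C f = d *\<^sub>C c *\<^sub>C f"
  by transfer (simp add: algebra_simps)

lemma complex_linear_add: "complex_linear S \<Longrightarrow> complex_linear T \<Longrightarrow> complex_linear (S + T)"
  by (simp add: complex_linear_def blinfun.add_left scaleC_add)

lemma complex_linear_op_scaleC: "complex_linear T \<Longrightarrow> complex_linear (op_scaleC c T)"
  by (simp add: complex_linear_def scaleC_scaleC)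

lemma complex_linear_tendsto:
  assumes "T \<longlonglongrightarrow> T'" "\<And>n. complex_linear (T n)"
  shows "complex_linear T'"
  unfolding complex_linear_def
proof (intro allI)
  fix c f
  have "(\<lambda>n. T n (c *\<^sub>C f)) \<longlonglongrightarrow> T' (c *\<^sub>C f)"
    by (intro blinfun.tendsto assms tendsto_const)
  moreover have "(\<lambda>n. scalar_op c (T n f)) \<longlonglongrightarrow> scalar_op c (T' f)"
    by (intro blinfun.tendsto assms tendsto_const)
  ultimately show "T' (c *\<^sub>C f) = c *\<^sub>C T' f"
    using assms(2) LIMSEQ_unique by (simp add: complex_linear_def scalar_op.rep_eq)
qed

section \<open>Positive functionals\<close>

lemma cstar_uminus:
  assumes "unital_cstar_subalgebra A" "T \<in> A"
  shows "- T \<in> A"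
  using assms op.scale_minus_left[of 1 T] op.scale_one unfolding unital_cstar_subalgebra_def by metis

text \<open>The square root is \<open>I - Y\<close>, where \<open>Y\<close> is the fixed point of the contraction
  \<open>Y \<mapsto> (H + Y\<^sup>2)/2\<close> of the ball of radius \<open>\<parallel>H\<parallel>\<close>.\<close>

lemma cstar_square_root:
  assumes A: "unital_cstar_subalgebra A" and H: "H \<in> A" "is_adjoint H H" "norm H < 1"
  obtains K where "K \<in> A" "is_adjoint K K" "K o\<^sub>L K = id_blinfun - H"
proof -
  define B where "B = {Y \<in> A. is_adjoint Y Y \<and> norm Y \<le> norm H}"
  define F where "F = (\<lambda>Y. op_scaleC (1/2) (H + (Y o\<^sub>L Y)))"
  \<comment> \<open>The complex factor 1/2 serves membership in \<open>A\<close> and adjoints; the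
    real one serves norms and algebra.\<close>
  have F2: "F Y = (1/2) *\<^sub>R (H + (Y o\<^sub>L Y))" for Y
    using op_scaleC_of_real[of "1/2"] by (simp add: F_def)
  have ncomp: "norm (X o\<^sub>L Y) \<le> norm H * norm Y" if "X \<in> B" for X Y :: fock_op
    using norm_blinfun_compose[of X Y] mult_right_mono[of "norm X" "norm H" "norm Y"] that
    by (simp add: B_def)
  have ncomp': "norm (Y o\<^sub>L X) \<le> norm H * norm Y" if "X \<in> B" for X Y :: fock_op
    using norm_blinfun_compose[of Y X] mult_left_mono[of "norm X" "norm H" "norm Y"] that
    by (simp add: B_def mult.commute)
  have seq: "Y \<in> B" if "\<And>n. X n \<in> B" "X \<longlonglongrightarrow> Y" for X Y
  proof -
    have "closed A" using A by (simp add: unital_cstar_subalgebra_def)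
    then have "Y \<in> A" using that closed_sequentially[of A X Y] by (auto simp: B_def)
    moreover have "is_adjoint Y Y" using is_adjoint_tendsto[OF that(2,2)] that(1) by (auto simp: B_def)
    moreover have "norm Y \<le> norm H"
      by (rule LIMSEQ_le_const2[OF tendsto_norm[OF that(2)]]) (use that(1) in \<open>auto simp: B_def\<close>)
    ultimately show ?thesis by (simp add: B_def)
  qed
  have "\<exists>!Y\<in>B. F Y = Y"
  proof (rule Banach_fix[where c = "norm H"])
    show "complete B"
      unfolding complete_eq_closed closed_sequential_limits using seq by blast
    show "B \<noteq> {}" using H by (auto simp: B_def)
    show "F ` B \<subseteq> B"
    proof (rule image_subsetI)
      fix Y assume Y: "Y \<in> B"
      have "F Y \<in> A"
        using A Y H unfolding F_def B_def unital_cstar_subalgebra_def by blast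
      moreover have "is_adjoint (F Y) (F Y)"
        using is_adjoint_scaleC[OF is_adjoint_add[OF H(2) is_adjoint_compose[of Y Y Y Y]], of "1/2"] Y
        by (simp add: F_def B_def)
      moreover have "norm (F Y) \<le> norm H"
      proof -
        have "norm (F Y) \<le> (1/2) * (norm H + norm (Y o\<^sub>L Y))"
          unfolding F2 by (simp add: norm_triangle_ineq)
        moreover have "norm (Y o\<^sub>L Y) \<le> 1 * norm Y"
          using ncomp[OF Y, of Y] mult_right_mono[of "norm H" 1 "norm Y"] H by simp
        ultimately show ?thesis using Y by (simp add: B_def)
      qed
      ultimately show "F Y \<in> B" by (simp add: B_def)
    qed
    fix X Y assume XY: "X \<in> B" "Y \<in> B"
    \<comment> \<open>\<open>X\<close> and \<open>Y\<close> need not commute, so the difference of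
      squares is split asymmetrically; the factor 1/2 absorbs the two terms, leaving the contraction
      constant \<open>norm H\<close>.\<close>
    have "F X - F Y = (1/2) *\<^sub>R ((X o\<^sub>L (X - Y)) + ((X - Y) o\<^sub>L Y))"
      by (rule blinfun_eqI) (simp add: F2 blinfun.bilinear_simps scaleR_diff_right scaleR_add_right)
    then have "norm (F X - F Y) \<le> (1/2) * (norm (X o\<^sub>L (X - Y)) + norm ((X - Y) o\<^sub>L Y))"
      by (simp add: norm_triangle_ineq)
    also have "\<dots> \<le> (1/2) * (norm H * norm (X - Y) + norm H * norm (X - Y))"
      using ncomp[OF XY(1)] ncomp'[OF XY(2)] by (intro mult_left_mono add_mono) auto
    finally show "dist (F X) (F Y) \<le> norm H * dist X Y" by (simp add: dist_norm)
  qed (use H in auto)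
  then obtain Y where Y: "Y \<in> B" "F Y = Y" by blast
  \<comment> \<open>The fixed point equation, solved for the square, turns (I - Y)^2 = I - 2Y + Y^2
    into I - H.\<close>
  have *: "Y o\<^sub>L Y = 2 *\<^sub>R Y - H"
    using arg_cong[OF Y(2), of "\<lambda>Z. 2 *\<^sub>R Z"] unfolding F2 by (simp add: algebra_simps)
  show ?thesis
  proof (rule that[of "id_blinfun + - Y"])
    show "id_blinfun + - Y \<in> A"
      using A Y cstar_uminus[OF A, of Y] unfolding unital_cstar_subalgebra_def B_def by blast
    show "is_adjoint (id_blinfun + - Y) (id_blinfun + - Y)"
      using is_adjoint_add[OF is_adjoint_id is_adjoint_scaleC[of Y Y "-1"]] Y by (simp add: B_def)
    have "(id_blinfun + - Y) o\<^sub>L (id_blinfun + - Y) = id_blinfun - 2 *\<^sub>R Y + (Y o\<^sub>L Y)"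
      by (rule blinfun_eqI) (simp add: blinfun.bilinear_simps scaleR_2)
    then show "(id_blinfun + - Y) o\<^sub>L (id_blinfun + - Y) = id_blinfun - H"
      unfolding * by simp
  qed
qed

section \<open>Hermiticity and continuity of states\<close>

context
  fixes A \<phi>
  assumes A: "unital_cstar_subalgebra A" and \<phi>: "\<phi> \<in> states A"
begin

lemma state_add: "S \<in> A \<Longrightarrow> T \<in> A \<Longrightarrow> \<phi> (S + T) = \<phi> S + \<phi> T"
  and state_scale: "T \<in> A \<Longrightarrow> \<phi> (op_scaleC c T) = c * \<phi> T"
  and state_positive: "S \<in> A \<Longrightarrow> T \<in> A \<Longrightarrow> is_adjoint S T \<Longrightarrow> \<phi> (S o\<^sub>L T) \<in> \<real>\<^sub>\<ge>\<^sub>0"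
  and state_id: "\<phi> id_blinfun = 1"
  using \<phi> by (auto simp: states_def)

lemma state_uminus: "T \<in> A \<Longrightarrow> \<phi> (- T) = - \<phi> T"
  using state_scale[of T "-1"] by simp

lemma state_diff: "S \<in> A \<Longrightarrow> T \<in> A \<Longrightarrow> \<phi> (S - T) = \<phi> S - \<phi> T"
  using state_add[of S "- T"] by (simp add: state_uminus cstar_uminus[OF A])

text \<open>For selfadjoint \<open>K\<close> of norm below 1 both I - K and I + K are squares of
  selfadjoint elements, so 1 - \<phi>(K) and 1 + \<phi>(K) are nonnegative reals: this gives reality
  and the bound at once. Square roots require a norm strictly below 1, so \<open>H\<close> is
  divided by an arbitrary r above \<open>norm H\<close>.\<close>

lemma state_selfadjoint:
  assumes H: "H \<in> A" "is_adjoint H H"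
  shows "\<phi> H \<in> \<real>" and "cmod (\<phi> H) \<le> norm H"
proof -
  have one: "1 - \<phi> K \<in> \<real>\<^sub>\<ge>\<^sub>0" if K: "K \<in> A" "is_adjoint K K" "norm K < 1" for K
  proof -
    obtain L where "L \<in> A" "is_adjoint L L" "L o\<^sub>L L = id_blinfun - K"
      using cstar_square_root[OF A K] .
    then have "\<phi> (id_blinfun - K) \<in> \<real>\<^sub>\<ge>\<^sub>0" using state_positive by metis
    then show ?thesis
      using A K by (simp add: state_diff state_id unital_cstar_subalgebra_def)
  qed
  have *: "\<phi> H \<in> \<real> \<and> cmod (\<phi> H) \<le> r" if r: "r > norm H" for r
  proof -
    have r0: "r > 0" using r norm_ge_zero[of H] by linarith
    define c where "c = complex_of_real (1 / r)"
    define K where "K = op_scaleC c H"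
    have K: "K \<in> A" "is_adjoint K K"
      using A H is_adjoint_scaleC[OF H(2), of c]
      by (simp_all add: K_def c_def unital_cstar_subalgebra_def)
    have K1: "norm K < 1"
      unfolding K_def c_def op_scaleC_of_real using r r0 by (simp add: field_simps)
    have nK: "- K \<in> A" "is_adjoint (- K) (- K)" "norm (- K) < 1"
      using K K1 cstar_uminus[OF A] is_adjoint_scaleC[OF K(2), of "-1"] by simp_all
    have *: "1 - \<phi> K \<in> \<real>\<^sub>\<ge>\<^sub>0" "1 + \<phi> K \<in> \<real>\<^sub>\<ge>\<^sub>0"
      using one[OF K K1] one[OF nK] state_uminus[OF K(1)] by simp_all
    have KH: "\<phi> K = c * \<phi> H" unfolding K_def by (rule state_scale[OF H(1)])
    have Im: "Im (\<phi> K) = 0" and Re: "\<bar>Re (\<phi> K)\<bar> \<le> 1"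
      using * by (auto simp: complex_nonneg_Reals_iff)
    then have "cmod (\<phi> K) \<le> 1" by (simp add: cmod_eq_Re)
    then have "cmod (\<phi> H) \<le> r"
      unfolding KH c_def norm_mult norm_of_real using r0 by (simp add: field_simps)
    moreover have "Im (\<phi> H) = 0" using Im r0 unfolding KH c_def by (simp add: Im_divide_of_real)
    ultimately show ?thesis by (simp add: complex_is_Real_iff)
  qed
  show "\<phi> H \<in> \<real>" using * gt_ex by blast
  show "cmod (\<phi> H) \<le> norm H"
    using * dense_ge by blast
qed

text \<open>Cartesian decomposition: \<open>H\<close> and \<open>K\<close> are selfadjoint and 2T =
  H + iK. Each has norm at most 2 \<open>norm T\<close>, so halving the sum leaves the factor
  2.\<close>

lemma state_adjoint:
  assumes "S \<in> A" "T \<in> A" "is_adjoint S T"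
  shows "\<phi> S = cnj (\<phi> T)" and "cmod (\<phi> T) \<le> 2 * norm T"
proof -
  define H K where "H = S + T" and "K = op_scaleC \<i> (S - T)"
  have mem: "S - T \<in> A" "H \<in> A"
    using assms A cstar_uminus[OF A, of T]
    by (auto simp: H_def unital_cstar_subalgebra_def diff_conv_add_uminus simp del: add_uminus_conv_diff)
  then have memK: "K \<in> A" using A by (simp add: K_def unital_cstar_subalgebra_def)
  have "is_adjoint H H"
    using is_adjoint_add[OF assms(3) is_adjoint_sym[OF assms(3)]] by (simp add: H_def add.commute)
  note HH = state_selfadjoint[OF mem(2) this]
  have "is_adjoint (S + op_scaleC (-1) T) (T + op_scaleC (-1) S)"
    using is_adjoint_add[OF assms(3) is_adjoint_scaleC[OF is_adjoint_sym[OF assms(3)], of "-1"]] by simp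
  from is_adjoint_scaleC[OF this, of \<i>] have "is_adjoint K K"
    by (simp add: K_def op.scale_right_diff_distrib)
  note KK = state_selfadjoint[OF memK this]
  have e: "\<phi> H = \<phi> S + \<phi> T" "\<phi> K = \<i> * (\<phi> S - \<phi> T)"
    using assms mem by (simp_all add: H_def K_def state_add state_diff state_scale)
  show "\<phi> S = cnj (\<phi> T)"
    using HH(1) KK(1) unfolding e by (simp add: complex_is_Real_iff complex_eq_iff)
  have nS: "norm S \<le> norm T" by (rule is_adjoint_norm_le[OF assms(3)])
  have "norm H \<le> 2 * norm T"
    using norm_triangle_ineq[of S T] nS by (simp add: H_def)
  moreover have "norm K \<le> 2 * norm T"
    using norm_op_scaleC[of \<i> "S - T"] norm_triangle_ineq4[of S T] nS by (simp add: K_def)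
  moreover have "2 * \<phi> T = \<phi> H + \<i> * \<phi> K"
    unfolding e by (simp add: algebra_simps)
  then have "cmod (2 * \<phi> T) \<le> cmod (\<phi> H) + cmod (\<phi> K)"
    using norm_triangle_ineq[of "\<phi> H" "\<i> * \<phi> K"] by (simp add: norm_mult)
  ultimately show "cmod (\<phi> T) \<le> 2 * norm T"
    using HH(2) KK(2) by (simp add: norm_mult)
qed

lemma state_bounded: "T \<in> A \<Longrightarrow> cmod (\<phi> T) \<le> 2 * norm T"
  using A state_adjoint(2) by (auto simp: unital_cstar_subalgebra_def)

lemma state_tendsto:
  assumes "\<And>n. X n \<in> A" "Y \<in> A" "X \<longlonglongrightarrow> Y"
  shows "(\<lambda>n. \<phi> (X n)) \<longlonglongrightarrow> \<phi> Y"
proof (rule LIM_zero_cancel, rule Lim_null_comparison)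
  have "X n - Y \<in> A" for n
    using A assms cstar_uminus[OF A, of Y] unfolding unital_cstar_subalgebra_def
    by (metis diff_conv_add_uminus)
  then show "\<forall>\<^sub>F n in sequentially. norm (\<phi> (X n) - \<phi> Y) \<le> 2 * norm (X n - Y)"
    using state_bounded by (simp add: assms flip: state_diff)
  show "(\<lambda>n. 2 * norm (X n - Y)) \<longlonglongrightarrow> 0"
    using LIM_zero[OF assms(3)] by (intro tendsto_mult_right_zero tendsto_norm_zero)
qed

end


section \<open>Words\<close>

text \<open>\<open>word is ks k\<close> maps \<open>basis (ks @ ys)\<close> to \<open>basis (is @ ys)\<close> if \<open>k\<close> is below all of \<open>ys\<close>, and
  kills the other basis vectors.  Under \<open>admissible\<close> this covers both kinds of words: a word is of
  type \<open>\<pi>\<close> if \<open>k\<close> exceeds all indices and of type \<open>\<lambda>\<close> if \<open>k\<close> is the largest index.\<close>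

definition word :: "int list \<Rightarrow> int list \<Rightarrow> int \<Rightarrow> fock_op"
  where "word is ks k = op_prod (map create is @ [annihilate k, create k] @ map annihilate (rev ks))"

definition admissible :: "int list \<Rightarrow> int list \<Rightarrow> int \<Rightarrow> bool"
  where "admissible is ks k \<longleftrightarrow> strict_incr is \<and> strict_incr ks \<and> (\<forall>x\<in>set is \<union> set ks. x \<le> k)"

lemma op_prod_Nil [simp]: "op_prod [] = id_blinfun"
  and op_prod_Cons [simp]: "op_prod (T # Ts) = T o\<^sub>L op_prod Ts"
  by (simp_all add: op_prod_def)

lemma blinfun_compose_assoc: "(R o\<^sub>L S) o\<^sub>L T = R o\<^sub>L (S o\<^sub>L T)"
  by (rule blinfun_eqI) simp

lemma blinfun_compose_id: "T o\<^sub>L id_blinfun = T" "id_blinfun o\<^sub>L T = T"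
  by (rule blinfun_eqI, simp)+

lemma op_prod_append: "op_prod (Ss @ Ts) = op_prod Ss o\<^sub>L op_prod Ts"
  by (induction Ss) (simp_all add: blinfun_compose_assoc blinfun_compose_id)

lemma coord_eq_0: "\<not> strict_incr xs \<Longrightarrow> coord f xs = 0"
  using coord[of f] by simp

lemma coord_prod_create:
  "coord (op_prod (map create is) f) xs =
    (if strict_incr xs \<and> take (length is) xs = is then coord f (drop (length is) xs) else 0)"
proof (induction "is" arbitrary: xs)
  case Nil
  then show ?case by (simp add: coord_eq_0)
next
  case (Cons i "is")
  then show ?case by (cases xs) (auto simp: coord_create)
qed

text \<open>No order condition is left over: if it fails at some stage, the full list is not
  increasing either and the coordinate vanishes anyway. For creators the condition must stay,
  because a suffix can be increasing when the whole list is not.\<close>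

lemma coord_prod_annihilate: "coord (op_prod (map annihilate js) f) xs = coord f (rev js @ xs)"
proof (induction js arbitrary: xs)
  case (Cons j js)
  have "\<not> strict_incr (j # xs) \<Longrightarrow> \<not> strict_incr (rev js @ j # xs)"
    by (auto simp: sorted_wrt_append)
  then show ?case
    using Cons by (simp add: coord_annihilate coord_eq_0)
qed simp

lemma strict_incr_append_above:
  assumes "strict_incr xs" "\<And>x. x \<in> set xs \<Longrightarrow> x \<le> k" "strict_incr (k # ys)"
  shows "strict_incr (xs @ ys)"
  using assms by (force simp: sorted_wrt_append)

lemma take_eq_append_iff: "take (length xs) zs = xs \<longleftrightarrow> (\<exists>ys. zs = xs @ ys)"
  by (metis append_eq_conv_conj append_take_drop_id)

text \<open>The middle factor contributes the condition that \<open>k\<close> lies below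
  \<open>ys\<close>. As \<open>k\<close> bounds all entries of \<open>is\<close>, this already
  implies the order condition of the creators, so a single condition survives.\<close>

lemma coord_word:
  assumes "admissible is ks k"
  shows "coord (word is ks k f) xs =
    (if \<exists>ys. xs = is @ ys \<and> strict_incr (k # ys) then coord f (ks @ drop (length is) xs) else 0)"
proof (cases "\<exists>ys. xs = is @ ys")
  case True
  then obtain ys where xs: "xs = is @ ys" by blast
  have "strict_incr (k # ys) \<Longrightarrow> strict_incr (is @ ys)"
    using assms by (intro strict_incr_append_above[of "is" k]) (auto simp: admissible_def)
  moreover have "strict_incr (is @ ys) \<Longrightarrow> strict_incr ys"
    by (simp add: sorted_wrt_append)
  ultimately show ?thesis
    unfolding word_def xs op_prod_append
    by (auto simp: coord_prod_create coord_prod_annihilate coord_annihilate coord_create)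
next
  case False
  then show ?thesis
    unfolding word_def op_prod_append by (auto simp: coord_prod_create take_eq_append_iff)
qed

lemma coord_word_append:
  "admissible is ks k \<Longrightarrow>
    coord (word is ks k f) (is @ ys) = (if strict_incr (k # ys) then coord f (ks @ ys) else 0)"
  by (simp add: coord_word)

lemma coord_word_eq_0:
  "admissible is ks k \<Longrightarrow> \<nexists>ys. xs = is @ ys \<and> strict_incr (k # ys) \<Longrightarrow> coord (word is ks k f) xs = 0"
  unfolding coord_word by (rule if_not_P)

text \<open>If \<open>k\<close> occurs in one of the lists, it is its last entry, and increasingness
  of both extended lists already forces \<open>k\<close> below \<open>ys\<close>. The middle factor
  then changes nothing.\<close>

lemma word_eq_lambda:
  assumes adm: "admissible is ks k" and k: "k \<in> set is \<union> set ks"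
  shows "word is ks k = op_prod (map create is @ map annihilate (rev ks))"
proof (rule blinfun_eqI, rule fock_eqI)
  fix f xs
  show "coord (word is ks k f) xs = coord (op_prod (map create is @ map annihilate (rev ks)) f) xs"
  proof (cases "\<exists>ys. xs = is @ ys")
    case True
    then obtain ys where xs: "xs = is @ ys" by blast
    have "strict_incr (k # ys) \<longleftrightarrow> strict_incr (is @ ys) \<and> strict_incr (ks @ ys)"
    proof
      assume "strict_incr (k # ys)"
      then show "strict_incr (is @ ys) \<and> strict_incr (ks @ ys)"
        using adm by (intro conjI strict_incr_append_above[of _ k]) (auto simp: admissible_def)
    qed (use k in \<open>auto simp: sorted_wrt_append\<close>)
    then show ?thesis
      unfolding xs op_prod_append
      by (auto simp: coord_word_append[OF adm] coord_prod_create coord_prod_annihilate coord_eq_0)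
  next
    case False
    then show ?thesis
      unfolding op_prod_append by (auto simp: coord_word[OF adm] coord_prod_create take_eq_append_iff)
  qed
qed

lemma words_eq: "lambda_words \<union> pi_words = {word is ks k | is ks k. admissible is ks k}"
proof (intro equalityI subsetI)
  fix T assume "T \<in> lambda_words \<union> pi_words"
  then consider (l) "is" js where "T = op_prod (map create is @ map annihilate js)"
      "strict_incr is" "strict_decr js" "length is + length js \<ge> 1"
    | (p) "is" k js where "T = op_prod (map create is @ [annihilate k, create k] @ map annihilate js)"
      "strict_incr (is @ [k])" "strict_decr (k # js)"
    unfolding lambda_words_def pi_words_def by blast
  then show "T \<in> {word is ks k | is ks k. admissible is ks k}"
  proof cases
    case l
    \<comment> \<open>A word of the first kind has no middle factor; inserting one at the largest
      index leaves it unchanged. Positive length makes the maximum exist.\<close>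
    define k where "k = Max (set is \<union> set js)"
    have "set is \<union> set js \<noteq> {}" using l(4) by auto
    then have k: "k \<in> set is \<union> set (rev js)"
      using Max_in[of "set is \<union> set js"] by (simp add: k_def)
    have adm: "admissible is (rev js) k"
      using l by (auto simp: admissible_def sorted_wrt_rev k_def)
    moreover have "T = word is (rev js) k" using word_eq_lambda[OF adm k] l(1) by simp
    ultimately show ?thesis by blast
  next
    case p
    have "admissible is (rev js) k"
      using p by (auto simp: admissible_def sorted_wrt_rev sorted_wrt_append less_imp_le)
    moreover have "T = word is (rev js) k" using p by (simp add: word_def)
    ultimately show ?thesis by blast
  qed
next
  fix T assume "T \<in> {word is ks k | is ks k. admissible is ks k}"
  then obtain "is" ks k where T: "T = word is ks k" and adm: "admissible is ks k" by blast
  show "T \<in> lambda_words \<union> pi_words"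
  proof (cases "k \<in> set is \<union> set ks")
    case True
    have "strict_decr (rev ks)" using adm by (simp add: admissible_def sorted_wrt_rev)
    moreover have "length is + length (rev ks) \<ge> 1"
      using True by (cases "is"; cases ks) auto
    ultimately have "T \<in> lambda_words"
      unfolding lambda_words_def T word_eq_lambda[OF adm True]
      using adm unfolding admissible_def by blast
    then show ?thesis by simp
  next
    case False
    then have lt: "\<forall>x\<in>set is \<union> set ks. x < k"
      using adm by (metis admissible_def order_le_less)
    then have "strict_incr (is @ [k])" "strict_decr (k # rev ks)"
      using adm by (auto simp: admissible_def sorted_wrt_rev sorted_wrt_append)
    then have "T \<in> pi_words"
      unfolding pi_words_def T word_def by blast
    then show ?thesis by simp
  qed
qed

section \<open>Adjoints, norms and products of words\<close>

lemma is_adjoint_op_prod: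
  "is_adjoint (op_prod (map create is)) (op_prod (map annihilate (rev is)))"
proof (induction "is")
  case (Cons i "is")
  then show ?case
    using is_adjoint_compose[OF is_adjoint_create[of i] Cons] by (simp add: op_prod_append blinfun_compose_id)
qed (simp add: is_adjoint_id)

lemma is_adjoint_word: "is_adjoint (word is ks k) (word ks is k)"
proof -
  have "is_adjoint (op_prod [annihilate k, create k]) (op_prod [annihilate k, create k])"
    using is_adjoint_compose[OF is_adjoint_sym[OF is_adjoint_create[of k]] is_adjoint_create[of k]]
    by (simp add: blinfun_compose_id)
  from is_adjoint_compose[OF is_adjoint_compose[OF is_adjoint_op_prod[of "is"] this]
      is_adjoint_sym[OF is_adjoint_op_prod[of ks]]]
  show ?thesis unfolding word_def op_prod_append by (simp add: blinfun_compose_assoc)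
qed

lemma complex_linear_op_prod: "(\<And>T. T \<in> set Ts \<Longrightarrow> complex_linear T) \<Longrightarrow> complex_linear (op_prod Ts)"
  by (induction Ts) (auto simp: complex_linear_def)

lemma complex_linear_create: "complex_linear (create i)"
  and complex_linear_annihilate: "complex_linear (annihilate i)"
  and complex_linear_shift: "complex_linear (shift k)"
  unfolding complex_linear_def
  by (auto intro!: fock_eqI simp: coord_create coord_annihilate coord_shift scaleC.rep_eq)

lemma complex_linear_word: "complex_linear (word is ks k)"
  unfolding word_def
  by (rule complex_linear_op_prod) (auto simp: complex_linear_create complex_linear_annihilate)

text \<open>A word is a partial isometry: it reindexes coordinates along an injection and discards
  the others.\<close>

lemma norm_word_le:
  assumes "admissible is ks k"
  shows "norm (word is ks k) \<le> 1"
proof (rule norm_blinfun_bound)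
  fix f
  let ?A = "{xs. \<exists>ys. xs = is @ ys \<and> strict_incr (k # ys)}"
  have inj: "inj_on (\<lambda>xs. ks @ drop (length is) xs) ?A"
    by (rule inj_onI) auto
  have "(norm (word is ks k f))\<^sup>2 \<le> (norm f)\<^sup>2"
    using square_summable_inj(2)[OF square_summable_coord inj, of f]
    by (simp add: norm_fock_square coord_word[OF assms])
  then show "norm (word is ks k f) \<le> 1 * norm f"
    by (simp add: power2_le_iff_abs_le)
qed simp

text \<open>On lists the product replaces the prefix \<open>ks'\<close> of \<open>ks' @ zs\<close>
  by \<open>is @ r\<close>, provided \<open>k\<close> lies below \<open>r @ zs\<close> and
  \<open>k'\<close> below \<open>zs\<close>. For empty \<open>r\<close> the two conditions merge
  into one for \<open>max k k'\<close>. For nonempty \<open>r\<close> above \<open>k\<close> one has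
  k < k', and the condition of \<open>k'\<close> implies the other. In the remaining case nothing
  survives.\<close>

lemma word_compose_prefix:
  assumes adm: "admissible is ks k" and adm': "admissible (ks @ r) ks' k'"
  shows "word is ks k o\<^sub>L word (ks @ r) ks' k' \<in> insert 0 (lambda_words \<union> pi_words)"
proof -
  have le: "x \<le> k" if "x \<in> set is \<union> set ks" for x
    using adm that by (auto simp: admissible_def)
  have le': "x \<le> k'" if "x \<in> set ks \<union> set r \<union> set ks'" for x
    using adm' that by (auto simp: admissible_def)
  have comp: "coord ((word is ks k o\<^sub>L word (ks @ r) ks' k') f) xs =
      (if \<exists>zs. xs = is @ r @ zs \<and> strict_incr (k # r @ zs) \<and> strict_incr (k' # zs)
       then coord f (ks' @ drop (length is + length r) xs) else 0)" for f xs
    using adm' by (auto simp: coord_word[OF adm] coord_word[OF adm'])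
  consider "r = []" | "r \<noteq> []" "strict_incr (k # r)" | "\<not> strict_incr (k # r)" by blast
  then show ?thesis
  proof cases
    case 1
    have adm'': "admissible is ks' (max k k')"
      using adm adm' le le' by (auto simp: admissible_def le_max_iff_disj)
    have "word is ks k o\<^sub>L word (ks @ r) ks' k' = word is ks' (max k k')"
      by (intro blinfun_eqI fock_eqI) (auto simp: comp[unfolded 1 append_Nil2] 1 coord_word[OF adm'']
        simp del: blinfun_apply_blinfun_compose)
    then show ?thesis using adm'' unfolding words_eq by blast
  next
    case 2
    have k: "k < k'" using 2 le' by (cases r) force+
    have adm'': "admissible (is @ r) ks' k'"
      using adm adm' strict_incr_append_above[OF _ le 2(2)] le le' k
      by (fastforce simp: admissible_def)
    have "strict_incr (k # r @ zs)" if "strict_incr (k' # zs)" for zs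
      using strict_incr_append_above[OF 2(2) _ that] le' k by (simp del: sorted_wrt.simps) force
    then have "word is ks k o\<^sub>L word (ks @ r) ks' k' = word (is @ r) ks' k'"
      by (intro blinfun_eqI fock_eqI) (auto simp: comp coord_word[OF adm'']
        simp del: blinfun_apply_blinfun_compose)
    then show ?thesis using adm'' unfolding words_eq by blast
  next
    case 3
    then have "\<not> strict_incr (k # r @ zs)" for zs by (auto simp: sorted_wrt_append)
    then have "word is ks k o\<^sub>L word (ks @ r) ks' k' = 0"
      by (intro blinfun_eqI fock_eqI) (simp add: comp zero_fock.rep_eq
        del: blinfun_apply_blinfun_compose sorted_wrt.simps)
    then show ?thesis by simp
  qed
qed

lemma is_adjoint_0: "is_adjoint 0 0"
  by (simp add: is_adjoint_def cinner.zero_left cinner.zero_right)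

lemma words_adjoint:
  assumes "T \<in> insert 0 (lambda_words \<union> pi_words)"
  obtains S where "S \<in> insert 0 (lambda_words \<union> pi_words)" "is_adjoint S T"
  using assms is_adjoint_word is_adjoint_0 unfolding words_eq admissible_def
  by (smt (verit, best) UnCI UnE insert_iff mem_Collect_eq)

text \<open>The right word outputs lists with prefix \<open>is'\<close>, the left word accepts those
  with prefix \<open>ks\<close>. Incomparable prefixes give 0. If \<open>ks\<close> is the longer
  one, passing to adjoints exchanges the roles and reduces to \<open>word_compose_prefix\<close>;
  uniqueness of adjoints brings the result back.\<close>

lemma words_compose:
  assumes "S \<in> lambda_words \<union> pi_words" "T \<in> lambda_words \<union> pi_words"
  shows "S o\<^sub>L T \<in> insert 0 (lambda_words \<union> pi_words)"
proof -
  obtain "is" ks k is' ks' k' where S: "S = word is ks k" and adm: "admissible is ks k"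
    and T: "T = word is' ks' k'" and adm': "admissible is' ks' k'"
    using assms unfolding words_eq by blast
  consider r where "is' = ks @ r" | r where "ks = is' @ r" | "\<nexists>ys zs. ks @ ys = is' @ zs"
    by (metis append_eq_append_conv2)
  then show ?thesis
  proof cases
    case 1
    then show ?thesis using word_compose_prefix[OF adm, of r] adm' S T by simp
  next
    case 2
    have a: "admissible ks' is' k'" "admissible (is' @ r) is k"
      using adm adm' 2 by (auto simp: admissible_def)
    obtain W where W: "W \<in> insert 0 (lambda_words \<union> pi_words)"
      "is_adjoint W (word ks' is' k' o\<^sub>L word (is' @ r) is k)"
      using words_adjoint[OF word_compose_prefix[OF a]] .
    have "is_adjoint (S o\<^sub>L T) (word ks' is' k' o\<^sub>L word (is' @ r) is k)"
      unfolding S T using is_adjoint_compose is_adjoint_word 2 by blast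
    then have "S o\<^sub>L T = W" using is_adjoint_unique W(2) by blast
    then show ?thesis using W(1) by simp
  next
    case 3
    have "coord ((S o\<^sub>L T) f) xs = 0" for f xs
      using 3 by (auto simp: S T coord_word[OF adm] coord_word[OF adm'])
    then have "S o\<^sub>L T = 0"
      by (intro blinfun_eqI fock_eqI) (simp add: zero_fock.rep_eq)
    then show ?thesis by simp
  qed
qed

section \<open>The structure of the monotone algebra\<close>

abbreviation word_span :: "fock_op set"
  where "word_span \<equiv> op.span (lambda_words \<union> pi_words)"

lemma monotone_ideal_iff: "T \<in> \<AA>\<^sub>m \<longleftrightarrow> (\<exists>X. (\<forall>n. X n \<in> word_span) \<and> X \<longlonglongrightarrow> T)"
  unfolding monotone_ideal_def closure_sequential by simp

lemma word_span_subset: "word_span \<subseteq> \<AA>\<^sub>m"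
  unfolding monotone_ideal_def by (rule closure_subset)

lemma word_mem_span: "admissible is ks k \<Longrightarrow> word is ks k \<in> word_span"
  by (rule op.span_base) (auto simp: words_eq)

lemma complex_linear_span: "T \<in> word_span \<Longrightarrow> complex_linear T"
proof (induction rule: op.span_induct_alt)
  case base
  then show ?case using complex_linear_op_scaleC[OF complex_linear_word, of 0] by simp
next
  case (step c x y)
  then show ?case
    using complex_linear_word unfolding words_eq
    by (auto intro!: complex_linear_add complex_linear_op_scaleC)
qed

lemma word_span_compose:
  assumes S: "S \<in> word_span" and T: "T \<in> word_span"
  shows "S o\<^sub>L T \<in> word_span"
proof -
  have *: "S o\<^sub>L T \<in> word_span" if W: "S \<in> lambda_words \<union> pi_words" for S
    using T
  proof (induction rule: op.span_induct_alt)
    case base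
    then show ?case by (simp add: op.span_zero)
  next
    case (step c x y)
    have "S o\<^sub>L op_scaleC c x = op_scaleC c (S o\<^sub>L x)"
      using complex_linear_span[OF op.span_base[OF W]] by (rule op_scaleC_compose_right)
    moreover have "S o\<^sub>L x \<in> word_span"
      using words_compose[OF W step(1)] by (auto intro: op.span_base op.span_zero)
    ultimately show ?case
      using step by (simp add: bounded_bilinear.add_right[OF bounded_bilinear_blinfun_compose] op.span_add op.span_scale)
  qed
  show ?thesis
    using S
  proof (induction rule: op.span_induct_alt)
    case base
    then show ?case by (simp add: op.span_zero)
  next
    case (step c x y)
    then show ?case
      using * by (simp add: bounded_bilinear.add_left[OF bounded_bilinear_blinfun_compose] op_scaleC_compose_left op.span_add op.span_scale)
  qed
qed

lemma word_span_adjoint: "T \<in> word_span \<Longrightarrow> \<exists>S\<in>word_span. is_adjoint S T"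
proof (induction rule: op.span_induct_alt)
  case base
  then show ?case using is_adjoint_0 op.span_zero by blast
next
  case (step c x y)
  then obtain S where S: "S \<in> word_span" "is_adjoint S y" by blast
  obtain R where R: "R \<in> word_span" "is_adjoint R x"
    using words_adjoint[of x] step by (metis insertCI insertE op.span_base op.span_zero)
  show ?case
    using is_adjoint_add[OF is_adjoint_scaleC[OF R(2), of "cnj c"] S(2)] R S
    by (intro bexI[of _ "op_scaleC (cnj c) R + S"]) (auto intro: op.span_add op.span_scale)
qed

lemma monotone_idealE:
  assumes "T \<in> \<AA>\<^sub>m"
  obtains X where "\<And>n. X n \<in> word_span" "X \<longlonglongrightarrow> T"
  using assms unfolding monotone_ideal_iff by blast

lemma monotone_idealI: "(\<And>n. X n \<in> word_span) \<Longrightarrow> X \<longlonglongrightarrow> T \<Longrightarrow> T \<in> \<AA>\<^sub>m"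
  unfolding monotone_ideal_iff by blast

lemma monotone_ideal_add:
  assumes "S \<in> \<AA>\<^sub>m" "T \<in> \<AA>\<^sub>m"
  shows "S + T \<in> \<AA>\<^sub>m"
  using assms
  by (elim monotone_idealE) (rule monotone_idealI[OF op.span_add tendsto_add])

lemma monotone_ideal_scale:
  assumes "T \<in> \<AA>\<^sub>m"
  shows "op_scaleC c T \<in> \<AA>\<^sub>m"
  using assms
  by (elim monotone_idealE)
     (rule monotone_idealI[OF op.span_scale bounded_linear.tendsto[OF bounded_linear_op_scaleC]])

lemma monotone_ideal_compose:
  assumes "S \<in> \<AA>\<^sub>m" "T \<in> \<AA>\<^sub>m"
  shows "S o\<^sub>L T \<in> \<AA>\<^sub>m"
  using assms
  by (elim monotone_idealE)
     (rule monotone_idealI[OF word_span_compose bounded_bilinear.tendsto[OF bounded_bilinear_blinfun_compose]])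

lemma complex_linear_monotone_ideal:
  assumes "T \<in> \<AA>\<^sub>m"
  shows "complex_linear T"
  using assms by (elim monotone_idealE) (rule complex_linear_tendsto[OF _ complex_linear_span])

text \<open>The adjoint is constructed as the limit of the adjoints of approximating elements of the
  span, which form a Cauchy sequence by \<open>is_adjoint_norm_le\<close>.\<close>

lemma monotone_ideal_adjoint:
  assumes "T \<in> \<AA>\<^sub>m"
  shows "\<exists>S\<in>\<AA>\<^sub>m. is_adjoint S T"
proof -
  obtain X where X: "\<And>n. X n \<in> word_span" "X \<longlonglongrightarrow> T"
    using assms by (rule monotone_idealE) blast
  obtain Y where Y: "\<And>n. Y n \<in> word_span" "\<And>n. is_adjoint (Y n) (X n)"
    using word_span_adjoint[OF X(1)] by metis
  have "norm (Y m - Y n) \<le> norm (X m - X n)" for m n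
    using is_adjoint_norm_le[OF is_adjoint_add[OF Y(2) is_adjoint_scaleC[OF Y(2), of "-1"]], of m n]
    by simp
  then have "Cauchy Y"
    using LIMSEQ_imp_Cauchy[OF X(2)] unfolding Cauchy_def dist_norm by (meson le_less_trans)
  then obtain S where S: "Y \<longlonglongrightarrow> S"
    using Cauchy_convergent convergent_def by blast
  then have "S \<in> \<AA>\<^sub>m" by (rule monotone_idealI[OF Y(1)])
  then show ?thesis
    using is_adjoint_tendsto[OF S X(2) Y(2)] by blast
qed

section \<open>Vector states escaping to minus infinity\<close>

text \<open>The state at infinity is the limit of these vector states.\<close>

definition far_state :: "nat \<Rightarrow> fock_op \<Rightarrow> complex"
  where "far_state n T = cinner (T (basis [- int n])) (basis [- int n])"

lemma far_state_eq_coord: "far_state n T = coord (T (basis [- int n])) [- int n]"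
  by (simp add: far_state_def cinner_basis)

lemma norm_basis: "strict_incr xs \<Longrightarrow> norm (basis xs) = 1"
  by (simp add: norm_fock_def inner_fock_def cinner_basis basis.rep_eq)

lemma far_state_add: "far_state n (S + T) = far_state n S + far_state n T"
  by (simp add: far_state_def blinfun.add_left cinner.add_left)

lemma far_state_scale: "far_state n (op_scaleC c T) = c * far_state n T"
  by (simp add: far_state_def cinner_scaleC_left)

lemma far_state_id: "far_state n id_blinfun = 1"
  by (simp add: far_state_eq_coord basis.rep_eq)

lemma norm_far_state_le: "cmod (far_state n T) \<le> norm T"
  using norm_coord_le[of "T (basis [- int n])" "[- int n]"] norm_blinfun[of T "basis [- int n]"]
  by (simp add: far_state_eq_coord norm_basis)

text \<open>For the one-entry list with entry -n to lie in the range of the word, either -n is an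
  entry of \<open>is\<close>, or \<open>is\<close> is empty and k < -n; large n excludes
  both.\<close>

lemma far_state_word:
  assumes adm: "admissible is ks k" and n: "int n > \<bar>k\<bar>" "\<And>x. x \<in> set is \<Longrightarrow> int n > \<bar>x\<bar>"
  shows "far_state n (word is ks k) = 0"
  unfolding far_state_eq_coord
proof (rule coord_word_eq_0[OF adm], safe)
  fix ys assume "[- int n] = is @ ys" "strict_incr (k # ys)"
  then show False using n by (cases "is") force+
qed

lemma far_state_span: "T \<in> word_span \<Longrightarrow> (\<lambda>n. far_state n T) \<longlonglongrightarrow> 0"
proof (induction rule: op.span_induct_alt)
  case base
  have "far_state n 0 = 0" for n using far_state_scale[of n 0 0] by simp
  then show ?case by simp
next
  case (step c x y)
  obtain "is" ks k where x: "x = word is ks k" and adm: "admissible is ks k"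
    using step(1) unfolding words_eq by blast
  define N where "N = nat (Max (abs ` insert k (set is)) + 1)"
  have "\<bar>x\<bar> < int n" if "n \<ge> N" "x \<in> insert k (set is)" for n x
  proof -
    have "\<bar>x\<bar> \<le> Max (abs ` insert k (set is))"
      using that by (intro Max_ge) blast+
    then show ?thesis using that(1) unfolding N_def by linarith
  qed
  then have "far_state n x = 0" if "n \<ge> N" for n
    using that unfolding x by (intro far_state_word[OF adm]) auto
  then have "(\<lambda>n. far_state n x) \<longlonglongrightarrow> 0"
    by (auto intro!: tendsto_eventually eventually_sequentiallyI)
  then have "(\<lambda>n. c * far_state n x + far_state n y) \<longlonglongrightarrow> c * 0 + 0"
    using step by (intro tendsto_intros)
  then show ?case by (simp add: far_state_add far_state_scale)
qed

text \<open>The functionals \<open>far_state n\<close> are contractive uniformly in n, so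
  convergence to 0 extends from the span to its closure.\<close>

lemma far_state_monotone_ideal:
  assumes "T \<in> \<AA>\<^sub>m"
  shows "(\<lambda>n. far_state n T) \<longlonglongrightarrow> 0"
proof (rule LIMSEQ_I)
  fix e :: real assume e: "e > 0"
  then have "e / 2 > 0" by simp
  then obtain S where S: "S \<in> word_span" "dist S T < e / 2"
    using assms unfolding monotone_ideal_def closure_approachable by blast
  obtain N where N: "\<And>n. n \<ge> N \<Longrightarrow> cmod (far_state n S) < e / 2"
    using LIMSEQ_D[OF far_state_span[OF S(1)] \<open>e / 2 > 0\<close>] by auto
  have "cmod (far_state n T - 0) < e" if "n \<ge> N" for n
  proof -
    have "far_state n T = far_state n S + far_state n (T - S)"
      using far_state_add[of n S "T - S"] by simp
    then show ?thesis
      using N[OF that] norm_far_state_le[of n "T - S"] S(2)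
        norm_triangle_ineq[of "far_state n S" "far_state n (T - S)"]
      by (simp add: dist_norm norm_minus_commute)
  qed
  then show "\<exists>N. \<forall>n\<ge>N. cmod (far_state n T - 0) < e" by blast
qed

lemma far_state_tendsto:
  assumes "X \<in> \<AA>\<^sub>m"
  shows "(\<lambda>n. far_state n (X + op_scaleC c id_blinfun)) \<longlonglongrightarrow> c"
  using tendsto_add[OF far_state_monotone_ideal[OF assms] tendsto_const[of c]]
  by (simp add: far_state_add far_state_scale far_state_id)

text \<open>The scalar is a limit of contractive functionals. Hence it depends continuously on the
  operator, which is what closedness of the unitization rests on.\<close>

lemma norm_scalar_part_le:
  assumes "X \<in> \<AA>\<^sub>m"
  shows "cmod c \<le> norm (X + op_scaleC c id_blinfun)"
  by (rule LIMSEQ_le_const2[OF tendsto_norm[OF far_state_tendsto[OF assms]]])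
     (use norm_far_state_le in blast)

section \<open>Identification of \<open>\<RR>\<^sub>m\<close> with the ideal plus scalars\<close>

definition unitization :: "fock_op set"
  where "unitization = {X + op_scaleC c id_blinfun | X c. X \<in> \<AA>\<^sub>m}"

lemma unitizationI: "X \<in> \<AA>\<^sub>m \<Longrightarrow> X + op_scaleC c id_blinfun \<in> unitization"
  unfolding unitization_def by blast

lemma monotone_ideal_0: "0 \<in> \<AA>\<^sub>m"
  using op.span_zero word_span_subset by blast

text \<open>Along a convergent sequence the scalar parts are Cauchy by
  \<open>norm_scalar_part_le\<close>; subtracting them shows that the ideal parts converge too, and
  the ideal is closed.\<close>

lemma closed_unitization: "closed unitization"
  unfolding closed_sequential_limits
proof (intro allI impI, elim conjE)
  fix T T' assume T: "\<forall>n. T n \<in> unitization" and lim: "T \<longlonglongrightarrow> T'"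
  obtain X c where X: "\<And>n. X n \<in> \<AA>\<^sub>m" "\<And>n. T n = X n + op_scaleC (c n) id_blinfun"
    using T unfolding unitization_def by simp metis
  have "cmod (c m - c n) \<le> norm (T m - T n)" for m n
  proof -
    have "X m + op_scaleC (-1) (X n) \<in> \<AA>\<^sub>m"
      using X by (intro monotone_ideal_add monotone_ideal_scale)
    from norm_scalar_part_le[OF this, of "c m - c n"] show ?thesis
      unfolding X(2) by (simp add: op.scale_left_diff_distrib algebra_simps)
  qed
  then have "Cauchy c"
    using LIMSEQ_imp_Cauchy[OF lim] unfolding Cauchy_def dist_norm by (meson le_less_trans)
  then obtain d where d: "c \<longlonglongrightarrow> d"
    using Cauchy_convergent convergent_def by blast
  have "(\<lambda>n. T n - op_scaleC (c n) id_blinfun) \<longlonglongrightarrow> T' - op_scaleC d id_blinfun"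
    by (intro tendsto_diff lim bounded_linear.tendsto[OF bounded_linear_op_scaleC_left] d)
  then have "X \<longlonglongrightarrow> T' - op_scaleC d id_blinfun"
    by (simp add: X(2))
  then have "T' - op_scaleC d id_blinfun \<in> \<AA>\<^sub>m"
    using X(1) closed_sequentially[of "\<AA>\<^sub>m" X] by (simp add: monotone_ideal_def)
  from unitizationI[OF this, of d] show "T' \<in> unitization" by simp
qed

lemma unital_cstar_unitization: "unital_cstar_subalgebra unitization"
  unfolding unital_cstar_subalgebra_def
proof (intro conjI ballI allI)
  show "closed unitization" by (rule closed_unitization)
  show "id_blinfun \<in> unitization"
    using unitizationI[OF monotone_ideal_0, of 1] by simp
next
  fix S T assume "S \<in> unitization" "T \<in> unitization"
  then obtain X Y c d where X: "X \<in> \<AA>\<^sub>m" "S = X + op_scaleC c id_blinfun"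
    and Y: "Y \<in> \<AA>\<^sub>m" "T = Y + op_scaleC d id_blinfun"
    unfolding unitization_def by blast
  have "S + T = (X + Y) + op_scaleC (c + d) id_blinfun"
    by (simp add: X Y op.scale_left_distrib algebra_simps)
  then show "S + T \<in> unitization"
    using X Y unitizationI monotone_ideal_add by metis
  have "S o\<^sub>L T = ((X o\<^sub>L Y) + (op_scaleC d X + op_scaleC c Y)) + op_scaleC (c * d) id_blinfun"
  proof (rule blinfun_eqI)
    fix f
    have "X (d *\<^sub>C f) = d *\<^sub>C X f"
      using complex_linear_monotone_ideal[OF X(1)] by (simp add: complex_linear_def)
    moreover have "c *\<^sub>C d *\<^sub>C f = (c * d) *\<^sub>C f" by transfer (simp add: mult.assoc)
    ultimately show "(S o\<^sub>L T) f =
        (((X o\<^sub>L Y) + (op_scaleC d X + op_scaleC c Y)) + op_scaleC (c * d) id_blinfun) f"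
      by (simp add: X Y blinfun.bilinear_simps scaleC_add add_ac)
  qed
  then show "S o\<^sub>L T \<in> unitization"
    using X Y unitizationI monotone_ideal_add monotone_ideal_scale monotone_ideal_compose by metis
next
  fix T assume "T \<in> unitization"
  then obtain X c where X: "X \<in> \<AA>\<^sub>m" and T: "T = X + op_scaleC c id_blinfun"
    unfolding unitization_def by blast
  have "complex_linear id_blinfun" by (simp add: complex_linear_def)
  then show "complex_linear T"
    unfolding T using complex_linear_monotone_ideal[OF X]
    by (intro complex_linear_add complex_linear_op_scaleC)
  fix d
  have "op_scaleC d T = op_scaleC d X + op_scaleC (d * c) id_blinfun"
    by (simp add: T op.scale_right_distrib)
  then show "op_scaleC d T \<in> unitization"
    using X unitizationI monotone_ideal_scale by metis
next
  fix T assume "T \<in> unitization"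
  then obtain X c where X: "X \<in> \<AA>\<^sub>m" and T: "T = X + op_scaleC c id_blinfun"
    unfolding unitization_def by blast
  obtain Y where Y: "Y \<in> \<AA>\<^sub>m" "is_adjoint Y X" using monotone_ideal_adjoint[OF X] by blast
  have "is_adjoint (Y + op_scaleC (cnj c) id_blinfun) T"
    using is_adjoint_add[OF Y(2) is_adjoint_scaleC[OF is_adjoint_id, of "cnj c"]] by (simp add: T)
  then show "\<exists>S\<in>unitization. is_adjoint S T" using unitizationI[OF Y(1)] by blast
qed

text \<open>Closure under adjoints only supplies some adjoint of \<open>annihilate i\<close>; by
  uniqueness it is \<open>create i\<close>. Words, span and closure follow.\<close>

lemma unitization_subset:
  assumes A: "unital_cstar_subalgebra A" and ann: "range annihilate \<subseteq> A"
  shows "unitization \<subseteq> A"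
proof -
  have cre: "create i \<in> A" for i
  proof -
    obtain S where "S \<in> A" "is_adjoint S (annihilate i)"
      using A ann unfolding unital_cstar_subalgebra_def by blast
    then show ?thesis using is_adjoint_unique is_adjoint_create by metis
  qed
  have op: "op_prod Ts \<in> A" if "set Ts \<subseteq> A" for Ts
    using that A by (induction Ts) (auto simp: unital_cstar_subalgebra_def)
  have word: "word is ks k \<in> A" for "is" ks k
    unfolding word_def by (rule op) (use cre ann in auto)
  have span: "T \<in> A" if "T \<in> word_span" for T
    using that
  proof (induction rule: op.span_induct_alt)
    case base
    have "op_scaleC 0 id_blinfun \<in> A" using A unfolding unital_cstar_subalgebra_def by blast
    then show ?case by simp
  next
    case (step c x y)
    then show ?case using A word unfolding words_eq unital_cstar_subalgebra_def by blast
  qed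
  have "\<AA>\<^sub>m \<subseteq> A"
    unfolding monotone_ideal_def
    by (rule closure_minimal) (use span A in \<open>auto simp: unital_cstar_subalgebra_def\<close>)
  then show ?thesis
    using A unfolding unitization_def unital_cstar_subalgebra_def by blast
qed

lemma annihilate_mem_monotone_ideal: "annihilate i \<in> \<AA>\<^sub>m"
proof -
  have "annihilate i = op_prod (map create [] @ map annihilate [i])"
    by (rule blinfun_eqI) simp
  then have "annihilate i \<in> lambda_words"
    unfolding lambda_words_def by fastforce
  then show ?thesis using word_span_subset op.span_base by blast
qed

lemma monotone_algebra_eq: "\<RR>\<^sub>m = unitization"
proof
  show "\<RR>\<^sub>m \<subseteq> unitization"
    unfolding monotone_algebra_def
  proof (rule hull_minimal)
    show "range annihilate \<subseteq> unitization"
      using unitizationI[OF annihilate_mem_monotone_ideal, of _ 0] by auto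
  qed (rule unital_cstar_unitization)
  show "unitization \<subseteq> \<RR>\<^sub>m"
    unfolding monotone_algebra_def hull_def using unitization_subset by blast
qed

lemma unital_cstar_monotone_algebra: "unital_cstar_subalgebra \<RR>\<^sub>m"
  by (simp add: monotone_algebra_eq unital_cstar_unitization)

lemma monotone_ideal_subset: "\<AA>\<^sub>m \<subseteq> \<RR>\<^sub>m"
  using unitizationI[of _ 0] by (auto simp: monotone_algebra_eq)

lemma word_mem: "admissible is ks k \<Longrightarrow> word is ks k \<in> \<RR>\<^sub>m"
  using word_mem_span word_span_subset monotone_ideal_subset by blast

section \<open>The two extremal states\<close>

lemma state_at_infinity_eq:
  assumes "X \<in> \<AA>\<^sub>m"
  shows "\<omega>\<^sub>\<infinity> (X + op_scaleC c id_blinfun) = c"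
proof -
  let ?T = "X + op_scaleC c id_blinfun"
  have "(THE d. \<exists>Y\<in>\<AA>\<^sub>m. ?T = Y + op_scaleC d id_blinfun) = c"
  proof (rule the_equality)
    show "\<exists>Y\<in>\<AA>\<^sub>m. ?T = Y + op_scaleC c id_blinfun" using assms by blast
    fix d assume "\<exists>Y\<in>\<AA>\<^sub>m. ?T = Y + op_scaleC d id_blinfun"
    then obtain Y where "Y \<in> \<AA>\<^sub>m" "?T = Y + op_scaleC d id_blinfun" by blast
    then show "d = c"
      using far_state_tendsto[OF assms, of c] far_state_tendsto[of Y d] LIMSEQ_unique by metis
  qed
  then show ?thesis
    using unitizationI[OF assms] unfolding state_at_infinity_def
    by (simp only: restrict_apply' monotone_algebra_eq)
qed

lemma far_state_tendsto_infinity: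
  assumes "T \<in> \<RR>\<^sub>m"
  shows "(\<lambda>n. far_state n T) \<longlonglongrightarrow> \<omega>\<^sub>\<infinity> T"
  using assms far_state_tendsto state_at_infinity_eq
  unfolding monotone_algebra_eq unitization_def by auto

lemma cinner_self_nonneg: "cinner f f \<in> \<real>\<^sub>\<ge>\<^sub>0"
proof -
  have "Im (cinner f f) = 0"
    using arg_cong[OF cinner_commute[of f f], of Im] by simp
  moreover have "Re (cinner f f) \<ge> 0" using inner_ge_zero[of f] by (simp add: inner_fock_def)
  ultimately show ?thesis by (simp add: complex_nonneg_Reals_iff)
qed

lemma state_at_infinity_mem_states: "\<omega>\<^sub>\<infinity> \<in> states \<RR>\<^sub>m"
  unfolding states_def
proof (intro CollectI conjI ballI allI impI)
  note R = unital_cstar_monotone_algebra[unfolded unital_cstar_subalgebra_def]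
  show "\<omega>\<^sub>\<infinity> \<in> extensional \<RR>\<^sub>m" by (simp add: state_at_infinity_def)
  show "\<omega>\<^sub>\<infinity> id_blinfun = 1" using state_at_infinity_eq[OF monotone_ideal_0, of 1] by simp
  fix S T assume ST: "S \<in> \<RR>\<^sub>m" "T \<in> \<RR>\<^sub>m"
  have "(\<lambda>n. far_state n (S + T)) \<longlonglongrightarrow> \<omega>\<^sub>\<infinity> S + \<omega>\<^sub>\<infinity> T"
    unfolding far_state_add by (intro tendsto_add far_state_tendsto_infinity ST)
  moreover have "S + T \<in> \<RR>\<^sub>m" using R ST by blast
  ultimately show "\<omega>\<^sub>\<infinity> (S + T) = \<omega>\<^sub>\<infinity> S + \<omega>\<^sub>\<infinity> T"
    using far_state_tendsto_infinity LIMSEQ_unique by blast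
  assume adj: "is_adjoint S T"
  have "S o\<^sub>L T \<in> \<RR>\<^sub>m" using R ST by blast
  \<comment> \<open>Moving \<open>S\<close> across the form leaves <Te, Te> for the basis vector
    e.\<close>
  moreover have "far_state n (S o\<^sub>L T) \<in> \<real>\<^sub>\<ge>\<^sub>0" for n
    unfolding far_state_def using cinner_self_nonneg is_adjointD[OF adj] by simp
  ultimately show "\<omega>\<^sub>\<infinity> (S o\<^sub>L T) \<in> \<real>\<^sub>\<ge>\<^sub>0"
    using closed_sequentially[OF closed_nonneg_Reals_complex _ far_state_tendsto_infinity] by blast
next
  note R = unital_cstar_monotone_algebra[unfolded unital_cstar_subalgebra_def]
  fix c T assume T: "T \<in> \<RR>\<^sub>m"
  have "(\<lambda>n. far_state n (op_scaleC c T)) \<longlonglongrightarrow> c * \<omega>\<^sub>\<infinity> T"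
    unfolding far_state_scale by (intro tendsto_mult tendsto_const far_state_tendsto_infinity T)
  moreover have "op_scaleC c T \<in> \<RR>\<^sub>m" using R T by blast
  ultimately show "\<omega>\<^sub>\<infinity> (op_scaleC c T) = c * \<omega>\<^sub>\<infinity> T"
    using far_state_tendsto_infinity LIMSEQ_unique by blast
qed

lemma cinner_vacuum: "cinner \<Omega> \<Omega> = 1"
  by (simp add: vacuum_def cinner_basis basis.rep_eq)

lemma vacuum_state_mem_states: "\<omega> \<in> states \<RR>\<^sub>m"
  using unital_cstar_monotone_algebra cinner_self_nonneg
  unfolding states_def vacuum_state_def unital_cstar_subalgebra_def
  by (auto simp: blinfun.add_left cinner.add_left cinner_scaleC_left is_adjointD cinner_vacuum)

lemma states_convex:
  assumes "\<phi> \<in> states A" "\<psi> \<in> states A" "0 \<le> t" "t \<le> 1" "unital_cstar_subalgebra A"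
  shows "(\<lambda>T\<in>A. (1 - of_real t) * \<phi> T + of_real t * \<psi> T) \<in> states A"
proof -
  have "(1 - of_real t) * \<phi> T + of_real t * \<psi> T \<in> \<real>\<^sub>\<ge>\<^sub>0" if "\<phi> T \<in> \<real>\<^sub>\<ge>\<^sub>0" "\<psi> T \<in> \<real>\<^sub>\<ge>\<^sub>0" for T
    using that assms(3,4) by (intro nonneg_Reals_add_I nonneg_Reals_mult_I)
      (simp_all add: complex_nonneg_Reals_iff)
  then show ?thesis
    using assms unfolding states_def unital_cstar_subalgebra_def by (auto simp: algebra_simps)
qed

section \<open>Shift invariance\<close>

lemma shift_inverse': "shift (-1) (shift 1 f) = f"
  using arg_cong[OF shift_inverse[of "-1"], of "\<lambda>T. T f"] by simp

lemma bounded_linear_shift_aut: "bounded_linear shift_aut"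
  unfolding shift_aut_def
  by (intro bounded_linear_compose[OF bounded_bilinear.bounded_linear_left[OF bounded_bilinear_blinfun_compose]]
      bounded_bilinear.bounded_linear_right[OF bounded_bilinear_blinfun_compose])

lemma shift_aut_compose: "shift_aut (S o\<^sub>L T) = shift_aut S o\<^sub>L shift_aut T"
  by (rule blinfun_eqI) (simp add: shift_aut_def shift_inverse')

lemma shift_aut_id: "shift_aut id_blinfun = id_blinfun"
  using arg_cong[OF shift_inverse[of 1], of blinfun_apply]
  by (intro blinfun_eqI) (simp add: shift_aut_def fun_eq_iff)

lemma shift_aut_scale: "shift_aut (op_scaleC c T) = op_scaleC c (shift_aut T)"
  using complex_linear_shift[of 1] by (intro blinfun_eqI) (simp add: shift_aut_def complex_linear_def)

lemma shift_aut_add: "shift_aut (S + T) = shift_aut S + shift_aut T"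
  by (rule linear_add[OF bounded_linear.linear[OF bounded_linear_shift_aut]])

lemma is_adjoint_shift_aut: "is_adjoint S T \<Longrightarrow> is_adjoint (shift_aut S) (shift_aut T)"
  using is_adjoint_compose[OF is_adjoint_compose[OF is_adjoint_shift[of 1]] is_adjoint_shift[of "-1"]]
  unfolding shift_aut_def by (simp add: blinfun_compose_assoc)

text \<open>Both sides are adjoint to the shifted annihilator, and adjoints are unique.\<close>

lemma shift_aut_create: "shift_aut (create i) = create (i + 1)"
  using is_adjoint_shift_aut[OF is_adjoint_create[of i]] is_adjoint_create[of "i + 1"]
    is_adjoint_unique unfolding shift_aut_annihilate by blast

lemma shift_aut_op_prod: "shift_aut (op_prod Ts) = op_prod (map shift_aut Ts)"
  by (induction Ts) (simp_all add: shift_aut_id shift_aut_compose)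

lemma shift_aut_word:
  "shift_aut (word is ks k) = word (map (\<lambda>j. j + 1) is) (map (\<lambda>j. j + 1) ks) (k + 1)"
  by (simp add: word_def shift_aut_op_prod shift_aut_create shift_aut_annihilate o_def rev_map)

lemma shift_aut_pow_word:
  "(shift_aut ^^ n) (word is ks k) =
    word (map (\<lambda>j. j + int n) is) (map (\<lambda>j. j + int n) ks) (k + int n)"
  by (induction n) (simp_all add: shift_aut_word o_def add_ac)

lemma admissible_map_add:
  "admissible is ks k \<Longrightarrow> admissible (map (\<lambda>j. j + m) is) (map (\<lambda>j. j + m) ks) (k + m)"
  by (auto simp: admissible_def strict_incr_map_add)

lemma shift_aut_span: "T \<in> word_span \<Longrightarrow> shift_aut T \<in> word_span"
proof (induction rule: op.span_induct_alt)
  case base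
  then show ?case
    by (simp add: linear_0[OF bounded_linear.linear[OF bounded_linear_shift_aut]] op.span_zero)
next
  case (step c x y)
  then have "shift_aut x \<in> word_span"
    using word_mem_span admissible_map_add unfolding words_eq by (auto simp: shift_aut_word)
  then show ?case
    using step by (simp add: shift_aut_add shift_aut_scale op.span_add op.span_scale)
qed

lemma shift_aut_monotone_ideal:
  assumes "T \<in> \<AA>\<^sub>m"
  shows "shift_aut T \<in> \<AA>\<^sub>m"
  using assms
  by (elim monotone_idealE)
     (rule monotone_idealI[OF shift_aut_span bounded_linear.tendsto[OF bounded_linear_shift_aut]])

lemma shift_aut_unitization:
  "shift_aut (X + op_scaleC c id_blinfun) = shift_aut X + op_scaleC c id_blinfun"
  by (simp add: shift_aut_add shift_aut_scale shift_aut_id)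

lemma shift_aut_mem: "T \<in> \<RR>\<^sub>m \<Longrightarrow> shift_aut T \<in> \<RR>\<^sub>m"
  using shift_aut_monotone_ideal unitizationI
  unfolding monotone_algebra_eq unitization_def[THEN eqset_imp_iff] by (auto simp: shift_aut_unitization)

lemma state_at_infinity_shift: "T \<in> \<RR>\<^sub>m \<Longrightarrow> \<omega>\<^sub>\<infinity> (shift_aut T) = \<omega>\<^sub>\<infinity> T"
  using shift_aut_monotone_ideal state_at_infinity_eq
  unfolding monotone_algebra_eq unitization_def by (auto simp: shift_aut_unitization)

lemma vacuum_state_shift: "T \<in> \<RR>\<^sub>m \<Longrightarrow> \<omega> (shift_aut T) = \<omega> T"
  using shift_aut_mem[of T] is_adjointD[OF is_adjoint_shift[of 1]]
  by (simp add: vacuum_state_def shift_aut_def vacuum_def shift_basis)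

section \<open>Vanishing of invariant states on words\<close>

lemma norm_sum_shifts_le:
  assumes adm: "admissible (i # is) ks k"
  shows "norm (\<Sum>n<N. (shift_aut ^^ n) (word (i # is) ks k)) \<le> sqrt (real N)"
proof (rule norm_blinfun_bound)
  fix f
  define U where "U = (\<lambda>n. (shift_aut ^^ n) (word (i # is) ks k))"
  have U: "U n = word (map (\<lambda>j. j + int n) (i # is)) (map (\<lambda>j. j + int n) ks) (k + int n)"
    and adm': "admissible (map (\<lambda>j. j + int n) (i # is)) (map (\<lambda>j. j + int n) ks) (k + int n)" for n
    using admissible_map_add[OF adm] by (simp_all only: U_def shift_aut_pow_word)
  \<comment> \<open>Source of the orthogonality: every vector in the range of the n-th translate is
    supported on lists starting with i + n.\<close>
  have hd: "xs \<noteq> [] \<and> hd xs = i + int n" if "coord (U n f) xs \<noteq> 0" for n xs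
    using that unfolding U coord_word[OF adm'] by (auto split: if_splits)
  have "orthogonal (U m f) (U n f)" if "m \<noteq> n" for m n
  proof -
    have "coord (U m f) xs * cnj (coord (U n f) xs) = 0" for xs
      using hd[of m xs] hd[of n xs] that by force
    then show ?thesis
      unfolding orthogonal_def inner_fock_def cinner_def by (simp only: infsum_0 zero_complex.sel)
  qed
  then have "(norm (\<Sum>n<N. U n f))\<^sup>2 = (\<Sum>n<N. (norm (U n f))\<^sup>2)"
    by (intro norm_sum_Pythagorean) (auto simp: pairwise_def)
  also have "\<dots> \<le> (\<Sum>n<N. (norm f)\<^sup>2)"
  proof (intro sum_mono power_mono)
    show "norm (U n f) \<le> norm f" for n
      using norm_blinfun[of "U n" f] mult_right_mono[OF norm_word_le[OF adm', of n] norm_ge_zero[of f]]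
      unfolding U by linarith
  qed simp
  also have "\<dots> = (sqrt (real N) * norm f)\<^sup>2"
    by (simp add: power_mult_distrib)
  finally show "norm ((\<Sum>n<N. (shift_aut ^^ n) (word (i # is) ks k)) f) \<le> sqrt (real N) * norm f"
    unfolding U_def blinfun.sum_left by (rule power2_le_imp_le) simp
qed simp

context
  fixes \<phi>
  assumes \<phi>: "\<phi> \<in> shift_invariant_states"
begin

lemma invariant_mem_states: "\<phi> \<in> states \<RR>\<^sub>m"
  using \<phi> by (simp add: shift_invariant_states_def)

lemma shift_aut_pow_mem: "T \<in> \<RR>\<^sub>m \<Longrightarrow> (shift_aut ^^ n) T \<in> \<RR>\<^sub>m"
  by (induction n) (auto intro: shift_aut_mem)

lemma invariant_pow: "T \<in> \<RR>\<^sub>m \<Longrightarrow> \<phi> ((shift_aut ^^ n) T) = \<phi> T"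
  using \<phi> by (induction n) (auto simp: shift_invariant_states_def shift_aut_pow_mem)

lemma invariant_sum:
  assumes "T \<in> \<RR>\<^sub>m"
  shows "(\<Sum>n<N. (shift_aut ^^ n) T) \<in> \<RR>\<^sub>m \<and> \<phi> (\<Sum>n<N. (shift_aut ^^ n) T) = of_nat N * \<phi> T"
proof (induction N)
  case 0
  have "0 \<in> \<RR>\<^sub>m" using monotone_ideal_0 monotone_ideal_subset by blast
  then show ?case
    using state_scale[OF unital_cstar_monotone_algebra invariant_mem_states, of 0 0] by simp
next
  case (Suc N)
  then show ?case
    using shift_aut_pow_mem[OF assms] unital_cstar_monotone_algebra invariant_pow[OF assms]
      state_add[OF unital_cstar_monotone_algebra invariant_mem_states]
    by (simp add: unital_cstar_subalgebra_def algebra_simps)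
qed

lemma invariant_word_create:
  assumes adm: "admissible (i # is) ks k"
  shows "\<phi> (word (i # is) ks k) = 0"
proof (rule ccontr)
  let ?c = "cmod (\<phi> (word (i # is) ks k))"
  assume "\<phi> (word (i # is) ks k) \<noteq> 0"
  then have c: "?c\<^sup>2 > 0" by simp
  \<comment> \<open>Squaring N c \<le> 2 sqrt N gives the 4; the 2 is the constant of
    \<open>state_bounded\<close>.\<close>
  have "real N * ?c\<^sup>2 \<le> 4" for N
  proof -
    note W = invariant_sum[OF word_mem[OF adm], of N]
    have "real N * ?c \<le> 2 * sqrt (real N)"
      using state_bounded[OF unital_cstar_monotone_algebra invariant_mem_states conjunct1[OF W]]
        norm_sum_shifts_le[OF adm, of N] W by (simp add: norm_mult)
    then have "(real N * ?c)\<^sup>2 \<le> (2 * sqrt (real N))\<^sup>2"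
      by (rule power_mono) simp
    then have "real N * (real N * ?c\<^sup>2) \<le> real N * 4"
      by (simp add: power_mult_distrib power2_eq_square[of "real N"] mult_ac)
    then show ?thesis by (cases "N = 0") (auto simp: mult_le_cancel_left_pos)
  qed
  moreover obtain N :: nat where "4 < real N * ?c\<^sup>2"
    using reals_Archimedean3[OF c] by blast
  ultimately show False by (meson not_le)
qed

lemma invariant_word:
  assumes adm: "admissible is ks k" and ne: "is \<noteq> [] \<or> ks \<noteq> []"
  shows "\<phi> (word is ks k) = 0"
proof (cases "is")
  case Nil
  then obtain j js where ks: "ks = j # js" using ne by (cases ks) auto
  have adm': "admissible ks is k" using adm by (auto simp: admissible_def)
  have "\<phi> (word is ks k) = cnj (\<phi> (word ks is k))"
    by (rule state_adjoint(1)[OF unital_cstar_monotone_algebra invariant_mem_states])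
       (use adm adm' word_mem is_adjoint_word in auto)
  then show ?thesis using invariant_word_create adm' unfolding ks by simp
next
  case Cons
  then show ?thesis using invariant_word_create adm by simp
qed

lemma invariant_projection: "\<phi> (word [] [] k) = \<phi> (word [] [] 0)"
proof -
  have *: "\<phi> (word [] [] (j + int n)) = \<phi> (word [] [] j)" for j n
    using invariant_pow[OF word_mem, of "[]" "[]" j n]
    by (simp add: shift_aut_pow_word admissible_def)
  \<comment> \<open>Only forward powers of the shift are at hand, so a negative \<open>k\<close> is
    itself moved up to 0.\<close>
  show ?thesis
    using *[of 0 "nat k"] *[of k "nat (- k)"] by (cases "k \<ge> 0") auto
qed

end

section \<open>Classification of the invariant states\<close>

lemma states_eqI:
  assumes \<phi>: "\<phi> \<in> states \<RR>\<^sub>m" and \<psi>: "\<psi> \<in> states \<RR>\<^sub>m"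
    and eq: "\<And>is ks k. admissible is ks k \<Longrightarrow> \<phi> (word is ks k) = \<psi> (word is ks k)"
  shows "\<phi> = \<psi>"
proof (rule extensionalityI)
  show "\<phi> \<in> extensional \<RR>\<^sub>m" "\<psi> \<in> extensional \<RR>\<^sub>m"
    using \<phi> \<psi> by (auto simp: states_def)
  note R = unital_cstar_monotone_algebra
  \<comment> \<open>Membership is carried through the induction because states are additive only on
    the algebra.\<close>
  have span: "T \<in> \<RR>\<^sub>m \<and> \<phi> T = \<psi> T" if "T \<in> word_span" for T
    using that
  proof (induction rule: op.span_induct_alt)
    case base
    have "0 \<in> \<RR>\<^sub>m" using monotone_ideal_0 monotone_ideal_subset by blast
    then show ?case
      using state_scale[OF R \<phi>, of 0 0] state_scale[OF R \<psi>, of 0 0] by simp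
  next
    case (step c x y)
    then have x: "x \<in> \<RR>\<^sub>m" "\<phi> x = \<psi> x"
      using word_mem eq unfolding words_eq by auto
    have "op_scaleC c x \<in> \<RR>\<^sub>m" using R x unfolding unital_cstar_subalgebra_def by blast
    then show ?case
      using step x R state_add[OF R \<phi>] state_add[OF R \<psi>] state_scale[OF R \<phi>] state_scale[OF R \<psi>]
      by (simp add: unital_cstar_subalgebra_def)
  qed
  have ideal: "\<phi> X = \<psi> X" if X: "X \<in> \<AA>\<^sub>m" for X
  proof -
    obtain Y where Y: "\<And>n. Y n \<in> word_span" "Y \<longlonglongrightarrow> X"
      using X unfolding monotone_ideal_iff by blast
    have "(\<lambda>n. \<phi> (Y n)) \<longlonglongrightarrow> \<phi> X" "(\<lambda>n. \<psi> (Y n)) \<longlonglongrightarrow> \<psi> X"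
      using state_tendsto[OF R \<phi>, of Y X] state_tendsto[OF R \<psi>, of Y X] span Y X monotone_ideal_subset
      by blast+
    then show ?thesis using span Y(1) LIMSEQ_unique by simp
  qed
  fix T assume "T \<in> \<RR>\<^sub>m"
  then obtain X c where X: "X \<in> \<AA>\<^sub>m" and T: "T = X + op_scaleC c id_blinfun"
    unfolding monotone_algebra_eq unitization_def by blast
  have "X \<in> \<RR>\<^sub>m" "id_blinfun \<in> \<RR>\<^sub>m" "op_scaleC c id_blinfun \<in> \<RR>\<^sub>m"
    using X monotone_ideal_subset R unfolding unital_cstar_subalgebra_def by blast+
  then show "\<phi> T = \<psi> T"
    unfolding T using ideal[OF X]
    by (simp add: state_add[OF R \<phi>] state_add[OF R \<psi>] state_scale[OF R \<phi>] state_scale[OF R \<psi>]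
        state_id[OF R \<phi>] state_id[OF R \<psi>])
qed

abbreviation mixture :: "real \<Rightarrow> fock_op \<Rightarrow> complex"
  where "mixture \<gamma> \<equiv> (\<lambda>T\<in>\<RR>\<^sub>m. (1 - of_real \<gamma>) * \<omega>\<^sub>\<infinity> T + of_real \<gamma> * \<omega> T)"

lemma mixture_mem:
  assumes "\<gamma> \<in> {0..1}"
  shows "mixture \<gamma> \<in> shift_invariant_states"
  using states_convex[OF state_at_infinity_mem_states vacuum_state_mem_states _ _
      unital_cstar_monotone_algebra, of \<gamma>] assms
  by (simp add: shift_invariant_states_def shift_aut_mem state_at_infinity_shift vacuum_state_shift)

text \<open>Mixtures differ only on the projections \<open>word [] [] k\<close>, where the value is
  \<gamma>; this tells how to read \<gamma> off a given state.\<close>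

lemma mixture_word:
  assumes "admissible is ks k"
  shows "mixture \<gamma> (word is ks k) = (if is = [] \<and> ks = [] then of_real \<gamma> else 0)"
proof -
  have "\<omega>\<^sub>\<infinity> (word is ks k) = 0"
    using state_at_infinity_eq[of "word is ks k" 0] word_mem_span[OF assms] word_span_subset by auto
  moreover have "\<omega> (word is ks k) = (if is = [] \<and> ks = [] then 1 else 0)"
    using assms word_mem[OF assms]
    by (simp add: vacuum_state_def vacuum_def cinner_basis coord_word basis.rep_eq)
  ultimately show ?thesis using word_mem[OF assms] by simp
qed

lemma invariant_eq_mixture:
  assumes "\<phi> \<in> shift_invariant_states"
  obtains \<gamma> where "\<gamma> \<in> {0..1}" "\<phi> = mixture \<gamma>"
proof -
  note R = unital_cstar_monotone_algebra
  note \<phi> = invariant_mem_states[OF assms]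
  let ?P = "word [] [] 0"
  have adm: "admissible [] [] k" for k by (simp add: admissible_def)
  have sa: "is_adjoint ?P ?P" by (rule is_adjoint_word)
  have "?P o\<^sub>L ?P = ?P"
    by (rule blinfun_eqI, rule fock_eqI) (auto simp: coord_word[OF adm] coord_eq_0)
  then have "\<phi> ?P \<in> \<real>\<^sub>\<ge>\<^sub>0"
    using state_positive[OF R \<phi> word_mem[OF adm] word_mem[OF adm] sa] by simp
  then have g: "\<phi> ?P = of_real (Re (\<phi> ?P))" "Re (\<phi> ?P) \<ge> 0"
    by (simp_all add: complex_nonneg_Reals_iff complex_eq_iff)
  \<comment> \<open>The sharp bound for selfadjoint elements is essential here: the general one
    would only give 2.\<close>
  have "Re (\<phi> ?P) \<le> 1"
    using state_selfadjoint(2)[OF R \<phi> word_mem[OF adm] sa] norm_word_le[OF adm[of 0]]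
      complex_Re_le_cmod[of "\<phi> ?P"] by linarith
  then have \<gamma>: "Re (\<phi> ?P) \<in> {0..1}" using g by simp
  have "\<phi> = mixture (Re (\<phi> ?P))"
  proof (rule states_eqI[OF \<phi> invariant_mem_states[OF mixture_mem[OF \<gamma>]]])
    fix "is" ks k assume "admissible is ks k"
    then show "\<phi> (word is ks k) = mixture (Re (\<phi> ?P)) (word is ks k)"
      unfolding mixture_word[OF \<open>admissible is ks k\<close>]
      using invariant_word[OF assms] invariant_projection[OF assms, of k] g(1) by simp
  qed
  then show ?thesis using that \<gamma> by blast
qed

theorem theorem5p12:
  shows "compactin (weak_star_topology \<RR>\<^sub>m) shift_invariant_states \<and>
    shift_invariant_states =
      {(\<lambda>T\<in>\<RR>\<^sub>m. (1 - of_real \<gamma>) * \<omega>\<^sub>\<infinity> T + of_real \<gamma> * \<omega> T) | \<gamma>. \<gamma> \<in> {0..1 :: real}}"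
proof -
  have eq: "shift_invariant_states = {mixture \<gamma> | \<gamma>. \<gamma> \<in> {0..1}}"
    using mixture_mem invariant_eq_mixture by blast
  \<comment> \<open>Compactness comes from the parametrization: each evaluation is affine in
    \<gamma>, so the mixtures form a continuous image of the unit interval.\<close>
  have "continuous_map euclideanreal (weak_star_topology \<RR>\<^sub>m) mixture"
    unfolding weak_star_topology_def continuous_map_componentwise
  proof (intro conjI ballI)
    fix T assume T: "T \<in> \<RR>\<^sub>m"
    have "continuous_on UNIV (\<lambda>\<gamma>. (1 - complex_of_real \<gamma>) * \<omega>\<^sub>\<infinity> T + of_real \<gamma> * \<omega> T)"
      by (intro continuous_intros)
    then show "continuous_map euclideanreal euclidean (\<lambda>\<gamma>. mixture \<gamma> T)"
      using T by simp
  qed auto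
  moreover have "compactin euclideanreal {0..1}" by simp
  ultimately have "compactin (weak_star_topology \<RR>\<^sub>m) (mixture ` {0..1})"
    by (intro image_compactin)
  moreover have "mixture ` {0..1} = {mixture \<gamma> | \<gamma>. \<gamma> \<in> {0..1}}" by blast
  ultimately show ?thesis using eq by simp
qed

end
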